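(* Let $S$ be the Sierpinski gasket in $\mathbb{R}^2$ with boundary vertices $\Gamma=\{a_1,a_2,a_3\}$, let $(V^n,\sim)$ be its $n$-th prefractal graph, $h_n=2^{-n}$, let $f:S\to\mathbb{R}$ be continuous with $\inf_S f>0$, and let $g:\Gamma\to\mathbb{R}$. Assume that $$g(x)\le \inf\Big\{\int_0^T f(\xi(t))\,dt+g(y)\Big\}\qquad\text{for all }x,y\in\Gamma,$$ where the infimum is over all absolutely continuous curves $\xi$ in $S$, defined on an interval from $0$ to $T$, with metric derivative $|\xi'|\le 1$ a.e., $\xi(0)=x$, $\xi(T)=y$; and that for every $n\in\mathbb{N}$ $$g(x)\le \inf\Big\{\sum_{k=0}^{N}h_nf(x_k)+g(y)\Big\}\qquad\text{for all }x,y\in\Gamma,$$ where the infimum is over all finite paths $\{x_0=x,x_1,\dots,x_N=y\}\subset V^n$ with $x_i\sim x_{i+1}$, $i=0,\dots,N-1$. For each $n$ let $u_{h_n}:V^n\to\mathbb{R}$ be the solution of the discrete eikonal equation $$\max_{y\sim x}\Big\{-\frac1{h_n}\big(u(y)-u(x)\big)\Big\}=f(x)\quad\text{for } x\in V^n\setminus\Gamma,\qquad u=g\ \text{ on }\Gamma,$$ and let $u:S\to\mathbb{R}$ be the metric viscosity solution of $|Du|=f$ in $S\setminus\Gamma$ with $u=g$ on $\Gamma$. Then, as $n\to+\infty$, $u_{h_n}$ converges uniformly to $u$, i.e. $\lim_{n\to\infty}\sup_{x\in V^n}|u_{h_n}(x)-u(x)|=0$.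
   Context: **Gasket and prefractal graphs.** $a_1,a_2,a_3$ are the vertices of an equilateral triangle of side $1$ in $\mathbb{R}^2$, $\Gamma=\{a_1,a_2,a_3\}$, $\psi_i(x)=a_i+\frac12(x-a_i)$. $V^n$ is the union of the images of $\Gamma$ under all $n$-fold compositions $\psi_{i_1}\circ\dots\circ\psi_{i_n}$; for $x,y\in V^n$, $x\sim y$ iff the segment joining $x$ and $y$ is the image of a side of the initial triangle under some $\psi_{i_1}\circ\dots\circ\psi_{i_n}$ (so $|x-y|=h_n=2^{-n}$). $S$ is the closure of $\bigcup_n V^n$. **Distance.** $d(x,y)$ is the geodesic distance on $S$: the infimum of the lengths of paths in $S$ joining $x$ to $y$. **Metric viscosity solutions on $S$.** For a curve $\xi:I\to S$ ($I$ an interval) the metric derivative is $|\xi'|(t)=\lim_{s\to t}d(\xi(s),\xi(t))/|s-t|$; $\xi$ is absolutely continuous if $|\xi'|(t)$ exists for a.e. $t$, $|\xi'|\in L^1_{loc}(I)$ and $d(\xi(s),\xi(t))\le\int_s^t|\xi'|(r)dr$ for $s\le t$. An admissible curve is an absolutely continuous one with $|\xi'|\le1$ a.e. Let $\Omega=S\setminus\Gamma$ (so $\partial\Omega=\Gamma$). A function is arcwise upper (lower) semicontinuous if its composition with every admissible curve is upper (lower) semicontinuous. $D^{+}w(t)$, $D^-w(t)$ denote the super- and subdifferential of $w$ at $t$ in the usual viscosity sense. An arcwise upper semicontinuous $u$ is a subsolution of $|Du|=f$ in $\Omega$ if for each $x\in\Omega$ and each admissible curve $\xi:I\to\Omega$,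 $I$ an open interval containing $0$, $\xi(0)=x$, the function $w=u\circ\xi$ satisfies $|p|\le f(x)$ for all $p\in D^+w(0)$. An arcwise lower semicontinuous $v$ is a supersolution if for each $x\in\Omega$ and $\varepsilon>0$ there are an admissible curve $\xi:\mathbb{R}\to S$ with $\xi(0)=x$ and a lower semicontinuous $w:\mathbb{R}\to\mathbb{R}$ such that $T^+=\inf\{t\ge0:\xi(t)\in\partial\Omega\}$ and $T^-=\sup\{t\le0:\xi(t)\in\partial\Omega\}$ are both finite, $w(0)=v(x)$, $w(t)\ge v(\xi(t))-\varepsilon$ for $t\in(T^-,T^+)$, and $|p|\ge f(\xi(t))-\varepsilon$ for all $p\in D^-w(t)$, $t\in(T^-,T^+)$. A solution is both a subsolution and a supersolution. *)

theory Defs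
  imports "HOL-Analysis.Analysis"
begin

section \<open>Curves in a metric space\<close>

text \<open>
  The distance \<open>d\<close> is an explicit parameter, since it will be the geodesic distance of a subset of
  the plane and not the ambient Euclidean one.
\<close>

definition metric_quot :: "('a \<Rightarrow> 'a \<Rightarrow> real) \<Rightarrow> (real \<Rightarrow> 'a) \<Rightarrow> real \<Rightarrow> real \<Rightarrow> real"
  where "metric_quot d \<xi> t s = d (\<xi> s) (\<xi> t) / \<bar>s - t\<bar>"

text \<open>
  \<open>metric_deriv\<close> is meaningful at those \<open>t \<in> I\<close> where the limit exists; \<open>abs_cont_curve\<close> demands
  this for almost every \<open>t \<in> I\<close>.
\<close>

definition metric_deriv :: "('a \<Rightarrow> 'a \<Rightarrow> real) \<Rightarrow> real set \<Rightarrow> (real \<Rightarrow> 'a) \<Rightarrow> real \<Rightarrow> real"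
  where "metric_deriv d I \<xi> t = Lim (at t within I) (metric_quot d \<xi> t)"

definition abs_cont_curve ::
    "('a \<Rightarrow> 'a \<Rightarrow> real) \<Rightarrow> 'a set \<Rightarrow> real set \<Rightarrow> (real \<Rightarrow> 'a) \<Rightarrow> bool"
  where "abs_cont_curve d X I \<xi> \<longleftrightarrow>
    is_interval I \<and> \<xi> ` I \<subseteq> X \<and>
    (AE t in lebesgue. t \<in> I \<longrightarrow> (\<exists>l. (metric_quot d \<xi> t \<longlongrightarrow> l) (at t within I))) \<and>
    (\<forall>K. compact K \<and> K \<subseteq> I \<longrightarrow> set_integrable lebesgue K (metric_deriv d I \<xi>)) \<and>
    (\<forall>s\<in>I. \<forall>t\<in>I. s \<le> t \<longrightarrow>
       d (\<xi> s) (\<xi> t) \<le> set_lebesgue_integral lebesgue {s..t} (metric_deriv d I \<xi>))"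

definition admissible ::
    "('a \<Rightarrow> 'a \<Rightarrow> real) \<Rightarrow> 'a set \<Rightarrow> real set \<Rightarrow> (real \<Rightarrow> 'a) \<Rightarrow> bool"
  where "admissible d X I \<xi> \<longleftrightarrow>
    abs_cont_curve d X I \<xi> \<and> (AE t in lebesgue. t \<in> I \<longrightarrow> metric_deriv d I \<xi> t \<le> 1)"

section \<open>Semicontinuity and semidifferentials\<close>

definition usc_on :: "real set \<Rightarrow> (real \<Rightarrow> real) \<Rightarrow> bool"
  where "usc_on I w \<longleftrightarrow> (\<forall>t\<in>I. \<forall>c > w t. \<forall>\<^sub>F s in at t within I. w s < c)"

definition lsc_on :: "real set \<Rightarrow> (real \<Rightarrow> real) \<Rightarrow> bool"
  where "lsc_on I w \<longleftrightarrow> (\<forall>t\<in>I. \<forall>c < w t. \<forall>\<^sub>F s in at t within I. c < w s)"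

definition arcwise_usc :: "('a \<Rightarrow> 'a \<Rightarrow> real) \<Rightarrow> 'a set \<Rightarrow> ('a \<Rightarrow> real) \<Rightarrow> bool"
  where "arcwise_usc d X u \<longleftrightarrow> (\<forall>I \<xi>. admissible d X I \<xi> \<longrightarrow> usc_on I (u \<circ> \<xi>))"

definition arcwise_lsc :: "('a \<Rightarrow> 'a \<Rightarrow> real) \<Rightarrow> 'a set \<Rightarrow> ('a \<Rightarrow> real) \<Rightarrow> bool"
  where "arcwise_lsc d X u \<longleftrightarrow> (\<forall>I \<xi>. admissible d X I \<xi> \<longrightarrow> lsc_on I (u \<circ> \<xi>))"

definition superdiff :: "(real \<Rightarrow> real) \<Rightarrow> real \<Rightarrow> real set"
  where "superdiff w t =
    {p. Limsup (at t) (\<lambda>s. ereal ((w s - w t - p * (s - t)) / \<bar>s - t\<bar>)) \<le> 0}"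

definition subdiff :: "(real \<Rightarrow> real) \<Rightarrow> real \<Rightarrow> real set"
  where "subdiff w t =
    {p. Liminf (at t) (\<lambda>s. ereal ((w s - w t - p * (s - t)) / \<bar>s - t\<bar>)) \<ge> 0}"

section \<open>Metric viscosity solutions of \<open>|Du| = f\<close> in \<open>X - B\<close>\<close>

definition metric_subsolution ::
    "('a \<Rightarrow> 'a \<Rightarrow> real) \<Rightarrow> 'a set \<Rightarrow> 'a set \<Rightarrow> ('a \<Rightarrow> real) \<Rightarrow> ('a \<Rightarrow> real) \<Rightarrow> bool"
  where "metric_subsolution d X B f u \<longleftrightarrow>
    arcwise_usc d X u \<and>
    (\<forall>x \<in> X - B. \<forall>I \<xi>.
       open I \<and> 0 \<in> I \<and> admissible d X I \<xi> \<and> \<xi> ` I \<subseteq> X - B \<and> \<xi> 0 = x \<longrightarrow>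
       (\<forall>p \<in> superdiff (u \<circ> \<xi>) 0. \<bar>p\<bar> \<le> f x))"

definition exit_pos :: "'a set \<Rightarrow> (real \<Rightarrow> 'a) \<Rightarrow> ereal"
  where "exit_pos B \<xi> = (INF t \<in> {t. 0 \<le> t \<and> \<xi> t \<in> B}. ereal t)"

definition exit_neg :: "'a set \<Rightarrow> (real \<Rightarrow> 'a) \<Rightarrow> ereal"
  where "exit_neg B \<xi> = (SUP t \<in> {t. t \<le> 0 \<and> \<xi> t \<in> B}. ereal t)"

definition metric_supersolution ::
    "('a \<Rightarrow> 'a \<Rightarrow> real) \<Rightarrow> 'a set \<Rightarrow> 'a set \<Rightarrow> ('a \<Rightarrow> real) \<Rightarrow> ('a \<Rightarrow> real) \<Rightarrow> bool"
  where "metric_supersolution d X B f v \<longleftrightarrow>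
    arcwise_lsc d X v \<and>
    (\<forall>x \<in> X - B. \<forall>\<epsilon> > 0. \<exists>\<xi> w.
       admissible d X UNIV \<xi> \<and> \<xi> 0 = x \<and> lsc_on UNIV w \<and>
       \<bar>exit_pos B \<xi>\<bar> \<noteq> \<infinity> \<and> \<bar>exit_neg B \<xi>\<bar> \<noteq> \<infinity> \<and> w 0 = v x \<and>
       (\<forall>t. exit_neg B \<xi> < ereal t \<and> ereal t < exit_pos B \<xi> \<longrightarrow>
          w t \<ge> v (\<xi> t) - \<epsilon> \<and> (\<forall>p \<in> subdiff w t. \<bar>p\<bar> \<ge> f (\<xi> t) - \<epsilon>)))"

definition metric_solution ::
    "('a \<Rightarrow> 'a \<Rightarrow> real) \<Rightarrow> 'a set \<Rightarrow> 'a set \<Rightarrow> ('a \<Rightarrow> real) \<Rightarrow> ('a \<Rightarrow> real) \<Rightarrow> bool"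
  where "metric_solution d X B f u \<longleftrightarrow>
    metric_subsolution d X B f u \<and> metric_supersolution d X B f u"

section \<open>The geodesic distance of a subset of a metric space\<close>

definition curve_length :: "(real \<Rightarrow> 'a::metric_space) \<Rightarrow> ereal"
  where "curve_length \<gamma> =
    (SUP ts \<in> {ts. sorted ts \<and> set ts \<subseteq> {0..1}}.
       ereal (\<Sum>i<length ts - 1. dist (\<gamma> (ts ! i)) (\<gamma> (ts ! Suc i))))"

text \<open>
  As a real number this is meaningful only if some path in \<open>X\<close> of finite length joins the two points,
  as is the case for any two points of the gasket.
\<close>

definition geodesic_dist :: "'a::metric_space set \<Rightarrow> 'a \<Rightarrow> 'a \<Rightarrow> real"
  where "geodesic_dist X x y = real_of_ereal
    (INF \<gamma> \<in> {\<gamma>. path \<gamma> \<and> path_image \<gamma> \<subseteq> X \<and> pathstart \<gamma> = x \<and> pathfinish \<gamma> = y}.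
       curve_length \<gamma>)"

section \<open>The Sierpinski gasket and its prefractal graphs\<close>

text \<open>
  The vertices \<open>a\<^sub>1, a\<^sub>2, a\<^sub>3\<close> are a function \<open>a\<close> on the three-element type \<open>3\<close>, so that
  \<open>\<Gamma> = range a\<close>; the composition \<open>\<psi>\<^bsub>i\<^sub>1\<^esub> \<circ> \<dots> \<circ> \<psi>\<^bsub>i\<^sub>n\<^esub>\<close> is \<open>gasket_comp a [i\<^sub>1, \<dots>, i\<^sub>n]\<close>.
\<close>

definition unit_triangle :: "(3 \<Rightarrow> real^2) \<Rightarrow> bool"
  where "unit_triangle a \<longleftrightarrow> (\<forall>i j. i \<noteq> j \<longrightarrow> dist (a i) (a j) = 1)"

definition gasket_map :: "(3 \<Rightarrow> real^2) \<Rightarrow> 3 \<Rightarrow> real^2 \<Rightarrow> real^2"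
  where "gasket_map a i x = a i + (1/2) *\<^sub>R (x - a i)"

definition gasket_comp :: "(3 \<Rightarrow> real^2) \<Rightarrow> 3 list \<Rightarrow> real^2 \<Rightarrow> real^2"
  where "gasket_comp a is = foldr (gasket_map a) is"

definition gasket_V :: "(3 \<Rightarrow> real^2) \<Rightarrow> nat \<Rightarrow> (real^2) set"
  where "gasket_V a n = (\<Union>is \<in> {is. length is = n}. gasket_comp a is ` range a)"

definition gasket_adj :: "(3 \<Rightarrow> real^2) \<Rightarrow> nat \<Rightarrow> real^2 \<Rightarrow> real^2 \<Rightarrow> bool"
  where "gasket_adj a n x y \<longleftrightarrow>
    x \<in> gasket_V a n \<and> y \<in> gasket_V a n \<and>
    (\<exists>is i j. length is = n \<and> i \<noteq> j \<and>
       closed_segment x y = gasket_comp a is ` closed_segment (a i) (a j))"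

definition gasket :: "(3 \<Rightarrow> real^2) \<Rightarrow> (real^2) set"
  where "gasket a = closure (\<Union>n. gasket_V a n)"

abbreviation gasket_dist :: "(3 \<Rightarrow> real^2) \<Rightarrow> real^2 \<Rightarrow> real^2 \<Rightarrow> real"
  where "gasket_dist a \<equiv> geodesic_dist (gasket a)"

definition mesh :: "nat \<Rightarrow> real"
  where "mesh n = 1 / 2 ^ n"

section \<open>The boundary compatibility infima and the discrete equation\<close>

definition curve_cost_inf ::
    "(3 \<Rightarrow> real^2) \<Rightarrow> (real^2 \<Rightarrow> real) \<Rightarrow> (real^2 \<Rightarrow> real) \<Rightarrow> real^2 \<Rightarrow> real^2 \<Rightarrow> ereal"
  where "curve_cost_inf a f g x y =
    Inf {ereal (set_lebesgue_integral lebesgue {0..T} (\<lambda>t. f (\<xi> t)) + g y) | T \<xi>.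
           0 \<le> T \<and> admissible (gasket_dist a) (gasket a) {0..T} \<xi> \<and> \<xi> 0 = x \<and> \<xi> T = y}"

definition graph_cost_inf ::
    "(3 \<Rightarrow> real^2) \<Rightarrow> nat \<Rightarrow> (real^2 \<Rightarrow> real) \<Rightarrow> (real^2 \<Rightarrow> real) \<Rightarrow> real^2 \<Rightarrow> real^2 \<Rightarrow> ereal"
  where "graph_cost_inf a n f g x y =
    Inf {ereal ((\<Sum>k=0..N. mesh n * f (p k)) + g y) | N p.
           (\<forall>k\<le>N. p k \<in> gasket_V a n) \<and> (\<forall>k<N. gasket_adj a n (p k) (p (Suc k))) \<and>
           p 0 = x \<and> p N = y}"

definition discrete_eikonal_solution ::
    "(3 \<Rightarrow> real^2) \<Rightarrow> nat \<Rightarrow> (real^2 \<Rightarrow> real) \<Rightarrow> (real^2 \<Rightarrow> real) \<Rightarrow> (real^2 \<Rightarrow> real) \<Rightarrow> bool"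
  where "discrete_eikonal_solution a n f g u \<longleftrightarrow>
    (\<forall>x \<in> gasket_V a n - range a.
       Max ((\<lambda>y. - (1 / mesh n) * (u y - u x)) ` {y. gasket_adj a n y x}) = f x) \<and>
    (\<forall>x \<in> range a. u x = g x)"

end

theory Submission
  imports Defs "HOL-Complex_Analysis.Great_Picard"
begin

text \<open>
  Both problems are compared along paths up to their first visit to \<open>\<Gamma>\<close>. An optimal path of the
  graph is a curve of unit speed in the gasket, and along each of its edges the subsolution property
  gives \<open>u x \<le> u y + h max f\<close>. Conversely the supersolution property yields, up to a small error, a
  curve from \<open>x\<close> to \<open>\<Gamma>\<close> with cost at most \<open>u x\<close>. Since cells of the same level meet only in vertices,
  such a curve visits adjacent vertices of \<open>V\<^sup>n\<close> successively and stays within distance \<open>h\<close> of the last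
  visited one, so it dominates a path of the graph. As \<open>f\<close> is bounded below, all paths involved have
  bounded length, and both errors are controlled by the modulus of continuity of \<open>f\<close> at scale \<open>h\<close>.

  The geodesic distance enters only in two ways: it is at least the Euclidean distance, so admissible
  curves are \<open>1\<close>-Lipschitz in the plane, and it equals the Euclidean distance along segments contained
  in the gasket.
\<close>

section \<open>One-dimensional viscosity inequalities\<close>

text \<open>Two definitions shape the proof. A supersolution supplies one curve through
  \<open>x\<close> that meets \<Gamma> both forwards and backwards in time, with a merely lower
  semicontinuous \<open>w\<close> that need not decrease in a prescribed direction. The cost bound
  is therefore won on at least one of the two branches, by contradiction, and only after stepping
  strictly inside the exit times. Secondly, \<open>geodesic_dist\<close> is the
  \<open>real_of_ereal\<close> of an infimum and would collapse to 0 for points joined by no path of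
  finite length. Even its lower bound by the Euclidean distance thus needs rectifiable paths, here
  1-Lipschitz ones from every point of the gasket to a vertex.

  The same paths bound \<open>U n\<close> from above independently of \<open>n\<close>; the first
  comparison then bounds \<open>u\<close> on \<open>gasket_V a n\<close>, and the second uses this
  bound. The outcome is an estimate \<open>\<omega> * K\<close>, where \<omega> is an oscillation
  bound of \<open>f\<close> at scale \<open>mesh n\<close> and \<open>K\<close> depends only on the
  bounds of \<open>f\<close> and \<open>g\<close>.\<close>

lemma usc_lsc_imp_continuous_on:
  assumes "usc_on I w" "lsc_on I w"
  shows "continuous_on I w"
  unfolding continuous_on_def
proof (intro ballI order_tendstoI)
  fix t b assume "t \<in> I"
  { assume "b < w t" then show "\<forall>\<^sub>F s in at t within I. b < w s"
      using assms(2) \<open>t \<in> I\<close> by (auto simp: lsc_on_def) }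
  { assume "w t < b" then show "\<forall>\<^sub>F s in at t within I. w s < b"
      using assms(1) \<open>t \<in> I\<close> by (auto simp: usc_on_def) }
qed

lemma DERIV_remainder_tendsto_0:
  fixes \<phi> :: "real \<Rightarrow> real"
  assumes "(\<phi> has_real_derivative p) (at t)"
  shows "((\<lambda>s. ereal ((\<phi> s - \<phi> t - p * (s - t)) / \<bar>s - t\<bar>)) \<longlongrightarrow> 0) (at t)"
proof -
  have "(\<phi> has_derivative (\<lambda>x. p * x)) (at t)"
    using assms by (simp add: has_field_derivative_def)
  then have "((\<lambda>s. (\<phi> s - \<phi> t - p * (s - t)) / \<bar>s - t\<bar>) \<longlongrightarrow> 0) (at t)"
    by (simp add: has_derivative_at_within divide_inverse mult.commute)
  then show ?thesis
    unfolding zero_ereal_def by (intro tendsto_ereal)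
qed

text \<open>The semidifferentials are defined by difference quotients; contact with a differentiable
  function is the form in which the comparison arguments produce slopes.\<close>

lemma superdiff_touching:
  fixes w \<phi> :: "real \<Rightarrow> real"
  assumes "(\<phi> has_real_derivative p) (at t)"
    and "\<forall>\<^sub>F s in at t. w s - \<phi> s \<le> w t - \<phi> t"
  shows "p \<in> superdiff w t"
proof -
  have "Limsup (at t) (\<lambda>s. ereal ((w s - w t - p * (s - t)) / \<bar>s - t\<bar>))
      \<le> Limsup (at t) (\<lambda>s. ereal ((\<phi> s - \<phi> t - p * (s - t)) / \<bar>s - t\<bar>))"
    using assms(2) by (intro Limsup_mono) (auto elim!: eventually_mono intro!: divide_right_mono)
  also have "\<dots> = 0"
    by (intro lim_imp_Limsup DERIV_remainder_tendsto_0 assms(1)) auto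
  finally show ?thesis by (simp add: superdiff_def)
qed

lemma subdiff_touching:
  fixes w \<phi> :: "real \<Rightarrow> real"
  assumes "(\<phi> has_real_derivative p) (at t)"
    and "\<forall>\<^sub>F s in at t. w t - \<phi> t \<le> w s - \<phi> s"
  shows "p \<in> subdiff w t"
proof -
  have "0 = Liminf (at t) (\<lambda>s. ereal ((\<phi> s - \<phi> t - p * (s - t)) / \<bar>s - t\<bar>))"
    by (intro lim_imp_Liminf[symmetric] DERIV_remainder_tendsto_0 assms(1)) auto
  also have "\<dots> \<le> Liminf (at t) (\<lambda>s. ereal ((w s - w t - p * (s - t)) / \<bar>s - t\<bar>))"
    using assms(2) by (intro Liminf_mono) (auto elim!: eventually_mono intro!: divide_right_mono)
  finally show ?thesis by (simp add: subdiff_def)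
qed

text \<open>The subsolution property tests a curve only at parameter 0; translation carries the test
  to every other time.\<close>

lemma superdiff_shift:
  "superdiff (\<lambda>s. w (t + s)) 0 = superdiff w t"
proof -
  have "at t = filtermap (\<lambda>s. t + s) (at 0)"
    using filtermap_at_shift[of "- t" 0] by (simp add: add.commute)
  then have "Limsup (at t) F = Limsup (at 0) (\<lambda>s. F (t + s))" for F :: "real \<Rightarrow> ereal"
    by (simp add: Limsup_filtermap_eq)
  then show ?thesis by (simp add: superdiff_def)
qed

text \<open>The sublevel sets at the values of \<open>w\<close> form a chain of nonempty compact
  sets, and a point common to all of them is a minimiser.\<close>

lemma lsc_on_attains_min:
  fixes w :: "real \<Rightarrow> real"
  assumes "lsc_on {a..b} w" "a \<le> b"
  obtains r where "r \<in> {a..b}" "\<And>s. s \<in> {a..b} \<Longrightarrow> w r \<le> w s"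
proof -
  have "\<exists>r\<in>{a..b}. \<forall>s\<in>{a..b}. w r \<le> w s"
  proof (rule ccontr)
    assume neg: "\<not> ?thesis"
    define V where "V c = {x \<in> {a..b}. w x \<le> c}" for c
    have "compact (V c)" for c
    proof -
      have "closedin (top_of_set {a..b}) (V c)"
        unfolding closedin_limpt
      proof (intro conjI allI impI)
        fix x assume x: "x islimpt V c \<and> x \<in> {a..b}"
        have "\<not> c < w x"
        proof
          assume "c < w x"
          then have "\<forall>\<^sub>F s in at x within {a..b}. c < w s"
            using assms(1) x by (auto simp: lsc_on_def)
          then obtain T where "open T" "x \<in> T" "\<And>s. s \<in> T \<Longrightarrow> s \<noteq> x \<Longrightarrow> s \<in> {a..b} \<Longrightarrow> c < w s"
            by (auto simp: eventually_at_topological)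
          moreover obtain y where "y \<in> V c" "y \<in> T" "y \<noteq> x"
            using x calculation by (meson islimptE)
          ultimately show False by (force simp: V_def)
        qed
        then show "x \<in> V c" using x by (simp add: V_def)
      qed (auto simp: V_def)
      then show ?thesis using closedin_compact by blast
    qed
    moreover have "{} \<notin> V ` w ` {a..b}" by (auto simp: V_def)
    ultimately have "\<Inter> (V ` w ` {a..b}) \<noteq> {}"
    proof (intro compact_chain)
      show "S \<subseteq> T \<or> T \<subseteq> S" if "S \<in> V ` w ` {a..b} \<and> T \<in> V ` w ` {a..b}" for S T
        using that by (auto simp: V_def image_iff)
    qed auto
    then obtain r where "\<forall>s\<in>{a..b}. r \<in> V (w s)" by auto
    moreover have "a \<in> {a..b}" using assms(2) by simp
    ultimately show False using neg by (fastforce simp: V_def)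
  qed
  then show ?thesis using that by blast
qed

text \<open>
  The test function \<open>\<kappa> / r - M' r\<close> with \<open>M' > M\<close> has slope below \<open>- M\<close>, and its pole keeps the
  touching point away from \<open>0\<close>.
\<close>

lemma superdiff_bounded_decrease:
  fixes w :: "real \<Rightarrow> real"
  assumes "0 < h" and cont: "continuous_on {0..h} w"
    and slope: "\<And>t p. 0 < t \<Longrightarrow> t < h \<Longrightarrow> p \<in> superdiff w t \<Longrightarrow> \<bar>p\<bar> \<le> M"
    and "0 \<le> M"
  shows "w 0 \<le> w h + M * h"
proof (rule ccontr)
  assume contra: "\<not> w 0 \<le> w h + M * h"
  have "M < (w 0 - w h) / h" using contra \<open>0 < h\<close> by (simp add: field_simps)
  then obtain M' where M': "M < M'" "M' < (w 0 - w h) / h" by (meson dense)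
  define \<theta> where "\<theta> r = w r + M' * r" for r
  have th: "\<theta> h < \<theta> 0" using M' \<open>0 < h\<close> by (simp add: \<theta>_def field_simps)
  have c\<theta>: "continuous_on {0..h} \<theta>" unfolding \<theta>_def by (intro continuous_intros cont)
  obtain C where C: "\<And>r. r \<in> {0..h} \<Longrightarrow> \<theta> r \<le> C"
    using continuous_attains_sup[OF compact_Icc _ c\<theta>] \<open>0 < h\<close> by fastforce
  have "((\<theta>) \<longlongrightarrow> \<theta> 0) (at 0 within {0..h})" using c\<theta> \<open>0 < h\<close> by (simp add: continuous_on)
  then have "\<forall>\<^sub>F r in at 0 within {0..h}. \<theta> h < \<theta> r" using th by (rule order_tendstoD)
  then have "\<forall>\<^sub>F r in at_right 0. \<theta> h < \<theta> r"
    using \<open>0 < h\<close> by (simp add: at_within_Icc_at_right)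
  moreover have "\<forall>\<^sub>F r in at_right 0. r \<in> {0<..<h}"
    using \<open>0 < h\<close> by (rule eventually_at_right_real)
  ultimately have "\<forall>\<^sub>F r in at_right 0. \<theta> h < \<theta> r \<and> r \<in> {0<..<h}" by eventually_elim auto
  then obtain r1 where r1: "\<theta> h < \<theta> r1" "0 < r1" "r1 < h"
    using eventually_happens trivial_limit_at_right_real by (metis (lifting) greaterThanLessThan_iff)
  \<comment> \<open>With this choice the pole costs at \<open>r1\<close> only half of the gap
    \<open>\<theta> r1 - \<theta> h\<close>, so that \<open>\<theta>' r1\<close> still exceeds
    \<open>\<theta> h\<close>, hence also \<open>\<theta>' h\<close>. This excludes a maximum at
    \<open>h\<close>.\<close>
  define \<kappa> where "\<kappa> = (\<theta> r1 - \<theta> h) * r1 / 2"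
  have \<kappa>: "0 < \<kappa>" "\<kappa> / r1 < \<theta> r1 - \<theta> h" using r1 by (auto simp: \<kappa>_def)
  define \<theta>' where "\<theta>' r = \<theta> r - \<kappa> / r" for r
  define D where "D = C - \<theta>' r1"
  have D: "\<kappa> / r1 \<le> D" using C[of r1] r1 by (simp add: D_def \<theta>'_def)
  have Dpos: "0 < D" using D \<kappa> r1 by (smt (verit) divide_pos_pos)
  \<comment> \<open>At \<open>r2\<close> the pole has size \<open>D + 1\<close>, which puts
    \<open>\<theta>' r2\<close> at least 1 below \<open>\<theta>' r1\<close> whatever
    \<open>\<theta> r2\<close> is. The maximum over \<open>{r2..h}\<close> is therefore
    interior.\<close>
  define r2 where "r2 = \<kappa> / (D + 1)"
  have r2: "0 < r2" "\<kappa> / r2 = D + 1" using \<kappa> Dpos by (auto simp: r2_def)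
  have "\<kappa> / r1 < \<kappa> / r2" using D r2 by simp
  then have r21: "r2 < r1"
    using \<kappa>(1) r1(2) r2(1) divide_left_mono[of r1 r2 \<kappa>] by (cases "r2 < r1") auto
  have "continuous_on {r2..h} \<theta>'" unfolding \<theta>'_def
    using r2 by (intro continuous_intros continuous_on_subset[OF c\<theta>]) auto
  then obtain r where r: "r \<in> {r2..h}" and max: "\<And>s. s \<in> {r2..h} \<Longrightarrow> \<theta>' s \<le> \<theta>' r"
    using continuous_attains_sup[OF compact_Icc, of r2 h \<theta>'] r21 r1 by fastforce
  have "\<theta>' r1 \<le> \<theta>' r" using max r1 r21 by simp
  moreover have "\<theta>' r2 < \<theta>' r1" using C[of r2] r2 r21 r1 by (simp add: \<theta>'_def D_def)
  moreover have "\<theta>' h < \<theta>' r1"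
    using \<kappa> \<open>0 < h\<close> by (smt (verit) \<theta>'_def divide_pos_pos)
  ultimately have "r \<noteq> r2" "r \<noteq> h" by auto
  then have rin: "r2 < r" "r < h" using r by auto
  define p where "p = - M' - \<kappa> / r\<^sup>2"
  have "((\<lambda>s. \<kappa> / s - M' * s) has_real_derivative p) (at r)"
    using rin r2 unfolding p_def
    by (auto intro!: derivative_eq_intros simp: power2_eq_square)
  moreover have "\<forall>\<^sub>F s in at r. s \<in> {r2<..<h}"
    using rin by (intro eventually_at_in_open') auto
  then have "\<forall>\<^sub>F s in at r. w s - (\<kappa> / s - M' * s) \<le> w r - (\<kappa> / r - M' * r)"
  proof eventually_elim
    case (elim s)
    then have "\<theta>' s \<le> \<theta>' r" using max by simp
    then show ?case by (simp add: \<theta>'_def \<theta>_def)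
  qed
  ultimately have "p \<in> superdiff w r" by (rule superdiff_touching)
  then have "\<bar>p\<bar> \<le> M" using slope[of r p] rin r2(1) by simp
  moreover have "0 \<le> \<kappa> / r\<^sup>2" using \<kappa> by simp
  ultimately show False using M' by (simp add: p_def)
qed

text \<open>
  \<open>sqrt (G\<^sup>2 + \<kappa>\<^sup>2)\<close> smooths the kink of \<open>\<bar>G\<bar>\<close> at \<open>0\<close> while its slope stays strictly below \<open>F\<close>, so
  \<open>w + sqrt (G\<^sup>2 + \<kappa>\<^sup>2)\<close> has no interior local minimum.
\<close>

lemma subdiff_bounded_increase:
  fixes w G F :: "real \<Rightarrow> real"
  assumes "s0 < 0" "0 < t0" and lsc: "lsc_on UNIV w"
    and G: "\<And>r. r \<in> {s0<..<t0} \<Longrightarrow> (G has_real_derivative F r) (at r)" and "G 0 = 0"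
    and F: "\<And>r. r \<in> {s0<..<t0} \<Longrightarrow> 0 < F r"
    and contG: "continuous_on {s0..t0} G"
    and slope: "\<And>r p. r \<in> {s0<..<t0} \<Longrightarrow> p \<in> subdiff w r \<Longrightarrow> F r \<le> \<bar>p\<bar>"
  shows "min (w t0 + G t0) (w s0 - G s0) \<le> w 0"
proof (rule ccontr)
  assume contra: "\<not> min (w t0 + G t0) (w s0 - G s0) \<le> w 0"
  \<comment> \<open>Smoothing raises the value at 0 by exactly \<kappa>, since
    \<open>G 0 = 0\<close>, while at the ends \<open>\<psi>\<close> exceeds
    \<open>\<bar>G\<bar>\<close>. Half of the gap thus keeps the value at 0 below both end values
    and forces an interior minimum.\<close>
  define \<kappa> where "\<kappa> = (min (w t0 + G t0) (w s0 - G s0) - w 0) / 2"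
  have \<kappa>: "0 < \<kappa>" "w 0 + \<kappa> < w t0 + G t0" "w 0 + \<kappa> < w s0 - G s0"
    using contra by (auto simp: \<kappa>_def field_simps)
  define \<psi> where "\<psi> r = sqrt ((G r)\<^sup>2 + \<kappa>\<^sup>2)" for r
  have pos: "0 < (G r)\<^sup>2 + \<kappa>\<^sup>2" for r using \<kappa> by (simp add: add_nonneg_pos)
  have absG: "\<bar>G r\<bar> < \<psi> r" for r
    unfolding \<psi>_def using \<kappa> by (intro real_less_rsqrt) simp
  have "lsc_on {s0..t0} (\<lambda>r. w r + \<psi> r)"
    unfolding lsc_on_def
  proof (intro ballI allI impI)
    fix t c assume t: "t \<in> {s0..t0}" and "c < w t + \<psi> t"
    define e where "e = (w t + \<psi> t - c) / 2"
    have "e > 0" using \<open>c < w t + \<psi> t\<close> by (simp add: e_def)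
    then have "\<forall>\<^sub>F s in at t. w t - e < w s" using lsc by (auto simp: lsc_on_def)
    then have "\<forall>\<^sub>F s in at t within {s0..t0}. w t - e < w s"
      using at_le[of "{s0..t0}" UNIV t] by (auto simp: filter_leD)
    moreover have "continuous_on {s0..t0} \<psi>" unfolding \<psi>_def by (intro continuous_intros contG)
    then have "(\<psi> \<longlongrightarrow> \<psi> t) (at t within {s0..t0})" using t by (simp add: continuous_on)
    then have "\<forall>\<^sub>F s in at t within {s0..t0}. \<psi> t - e < \<psi> s"
      using \<open>e > 0\<close> by (intro order_tendstoD) auto
    ultimately show "\<forall>\<^sub>F s in at t within {s0..t0}. c < w s + \<psi> s"
      by eventually_elim (simp add: e_def field_simps)
  qed
  then obtain r where r: "r \<in> {s0..t0}"
    and min: "\<And>s. s \<in> {s0..t0} \<Longrightarrow> w r + \<psi> r \<le> w s + \<psi> s"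
    by (rule lsc_on_attains_min) (use assms(1,2) in auto)
  have "w r + \<psi> r \<le> w 0 + \<kappa>" using min[of 0] assms(1,2) \<open>G 0 = 0\<close> \<kappa> by (simp add: \<psi>_def)
  then have "r \<noteq> s0" "r \<noteq> t0" using absG[of s0] absG[of t0] \<kappa> by (auto simp: abs_less_iff)
  then have rin: "r \<in> {s0<..<t0}" using r by auto
  define q where "q = G r * F r / \<psi> r"
  have "((\<lambda>s. - \<psi> s) has_real_derivative - q) (at r)"
    unfolding \<psi>_def q_def using pos[of r]
    by (auto intro!: derivative_eq_intros G[OF rin] simp: field_simps)
  moreover have "\<forall>\<^sub>F s in at r. s \<in> {s0<..<t0}"
    using rin by (intro eventually_at_in_open') auto
  then have "\<forall>\<^sub>F s in at r. w r - (- \<psi> r) \<le> w s - (- \<psi> s)"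
    by eventually_elim (use min in force)
  ultimately have "- q \<in> subdiff w r" by (rule subdiff_touching)
  then have "F r \<le> \<bar>q\<bar>" using slope[OF rin] by force
  moreover have "\<bar>q\<bar> = F r * (\<bar>G r\<bar> / \<psi> r)"
    using F[OF rin] absG[of r] by (simp add: q_def abs_mult)
  moreover have "\<bar>G r\<bar> / \<psi> r < 1" using absG[of r] by (simp add: divide_simps) linarith
  ultimately show False using F[OF rin] by (smt (verit) mult_less_cancel_left2)
qed

section \<open>Cells of the gasket\<close>

text \<open>
  Barycentric coordinates: \<open>(dist x (a j))\<^sup>2 - (dist x (a i))\<^sup>2\<close> is affine in \<open>x\<close> and equals the
  difference of the \<open>i\<close>-th and the \<open>j\<close>-th coordinate at the vertices of a unit triangle.
\<close>

definition bary :: "(3 \<Rightarrow> real^2) \<Rightarrow> 3 \<Rightarrow> real^2 \<Rightarrow> real"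
  where "bary a i x = (1 + (\<Sum>j\<in>UNIV. (dist x (a j))\<^sup>2 - (dist x (a i))\<^sup>2)) / 3"

text \<open>The reconstruction of \<open>x\<close> from its coordinates is part of the condition. It
  is closed and preserved by the maps, so the gasket inherits it and no argument on affine
  independence of the vertices is required.\<close>

definition triangle :: "(3 \<Rightarrow> real^2) \<Rightarrow> (real^2) set"
  where "triangle a = {x. (\<forall>i. 0 \<le> bary a i x) \<and> (\<Sum>i\<in>UNIV. bary a i x *\<^sub>R a i) = x}"

abbreviation cell :: "(3 \<Rightarrow> real^2) \<Rightarrow> 3 list \<Rightarrow> (real^2) set"
  where "cell a w \<equiv> gasket_comp a w ` gasket a"

section \<open>Contractions, vertex sets and invariance of the gasket\<close>

lemma mesh_pos: "0 < mesh n"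
  by (simp add: mesh_def)

lemma mesh_tendsto_0: "mesh \<longlonglongrightarrow> 0"
  using LIMSEQ_power_zero[of "1/2::real"] by (simp add: mesh_def[abs_def] power_divide)

lemma gasket_comp_Nil [simp]: "gasket_comp a [] x = x"
  by (simp add: gasket_comp_def)

lemma gasket_comp_Cons [simp]: "gasket_comp a (i # w) x = gasket_map a i (gasket_comp a w x)"
  by (simp add: gasket_comp_def)

lemma gasket_map_inj [simp]: "gasket_map a i x = gasket_map a i y \<longleftrightarrow> x = y"
  by (simp add: gasket_map_def)

lemma gasket_map_vertex [simp]: "gasket_map a i (a i) = a i"
  by (simp add: gasket_map_def)

lemma gasket_map_midpoint: "gasket_map a i x = (1/2) *\<^sub>R (a i + x)"
  by (simp add: gasket_map_def vec_eq_iff field_simps)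

lemma gasket_map_swap: "gasket_map a i (a j) = gasket_map a j (a i)"
  by (simp add: gasket_map_midpoint add.commute)

lemma dist_gasket_map: "dist (gasket_map a i x) (gasket_map a i y) = dist x y / 2"
proof -
  have "gasket_map a i x - gasket_map a i y = (1/2) *\<^sub>R (x - y)"
    by (simp add: gasket_map_def algebra_simps)
  then show ?thesis by (simp add: dist_norm)
qed

lemma dist_gasket_comp: "dist (gasket_comp a w x) (gasket_comp a w y) = mesh (length w) * dist x y"
  by (induction w) (auto simp: dist_gasket_map mesh_def)

lemma continuous_on_gasket_map: "continuous_on A (gasket_map a i)"
  unfolding gasket_map_def by (intro continuous_intros)

lemma continuous_on_gasket_comp: "continuous_on A (gasket_comp a w)"
  using lipschitz_onI[of A "gasket_comp a w" "mesh (length w)"] mesh_pos[of "length w"]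
  by (intro lipschitz_on_continuous_on) (auto simp: dist_gasket_comp less_imp_le)

lemma gasket_map_convex_comb:
  "gasket_map a i ((1 - u) *\<^sub>R x + u *\<^sub>R y) = (1 - u) *\<^sub>R gasket_map a i x + u *\<^sub>R gasket_map a i y"
  by (simp add: gasket_map_def vec_eq_iff field_simps)

lemma gasket_map_segment:
  "gasket_map a i ` closed_segment x y = closed_segment (gasket_map a i x) (gasket_map a i y)"
  by (simp add: closed_segment_image_interval image_image gasket_map_convex_comb)

lemma gasket_comp_segment:
  "gasket_comp a w ` closed_segment x y = closed_segment (gasket_comp a w x) (gasket_comp a w y)"
proof (induction w)
  case (Cons i w)
  have "gasket_comp a (i # w) ` A = gasket_map a i ` gasket_comp a w ` A" for A
    by (auto simp: image_image)
  with Cons show ?case by (simp add: gasket_map_segment)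
qed (simp add: image_def)

lemma gasket_V_0: "gasket_V a 0 = range a"
  by (auto simp: gasket_V_def)

lemma gasket_V_Suc: "gasket_V a (Suc n) = (\<Union>i. gasket_map a i ` gasket_V a n)"
proof -
  have "{w. length w = Suc n} = (\<Union>i. (#) i ` {w :: 3 list. length w = n})"
    by (auto simp: length_Suc_conv image_def)
  then show ?thesis
    by (simp add: gasket_V_def image_UN UN_extend_simps) (auto simp: image_iff; metis)
qed

lemma gasket_V_mono_Suc: "gasket_V a n \<subseteq> gasket_V a (Suc n)"
proof (induction n)
  case 0
  show ?case
    by (auto simp: gasket_V_0 gasket_V_Suc image_iff) (metis gasket_map_vertex)
next
  case (Suc n)
  then show ?case unfolding gasket_V_Suc[of a "Suc n"] by (subst gasket_V_Suc) (intro UN_mono image_mono order_refl)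
qed

lemma gasket_V_mono: "m \<le> n \<Longrightarrow> gasket_V a m \<subseteq> gasket_V a n"
  by (rule lift_Suc_mono_le[of "gasket_V a"]) (rule gasket_V_mono_Suc)

lemma finite_gasket_V: "finite (gasket_V a n)"
  using finite_lists_length_eq[of "UNIV :: 3 set" n] by (simp add: gasket_V_def)

lemma vertex_in_gasket_V: "a i \<in> gasket_V a n"
  using gasket_V_mono[of 0 n a] by (auto simp: gasket_V_0)

lemma gasket_V_subset: "gasket_V a n \<subseteq> gasket a"
  unfolding gasket_def by (rule order_trans[OF UN_upper closure_subset]) simp

lemma closed_gasket: "closed (gasket a)"
  by (simp add: gasket_def)

lemma gasket_map_in_gasket: "x \<in> gasket a \<Longrightarrow> gasket_map a i x \<in> gasket a"
proof -
  have "gasket_map a i ` closure (\<Union>n. gasket_V a n) \<subseteq> gasket a"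
  proof (rule image_closure_subset)
    have "gasket_map a i ` gasket_V a n \<subseteq> gasket a" for n
      using gasket_V_subset[of a "Suc n"] by (auto simp: gasket_V_Suc)
    then show "gasket_map a i ` (\<Union>n. gasket_V a n) \<subseteq> gasket a" by auto
  qed (simp_all add: continuous_on_gasket_map closed_gasket)
  then show "x \<in> gasket a \<Longrightarrow> ?thesis" by (auto simp: gasket_def)
qed

lemma gasket_comp_in_gasket: "x \<in> gasket a \<Longrightarrow> gasket_comp a w x \<in> gasket a"
  by (induction w) (auto simp: gasket_map_in_gasket)

lemma gasket_subset_closed:
  assumes "closed T" "range a \<subseteq> T" "\<And>i x. x \<in> T \<Longrightarrow> gasket_map a i x \<in> T"
  shows "gasket a \<subseteq> T"
proof -
  have "gasket_V a n \<subseteq> T" for n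
    by (induction n) (use assms in \<open>auto simp: gasket_V_0 gasket_V_Suc\<close>)
  then show ?thesis unfolding gasket_def by (intro closure_minimal assms(1)) auto
qed

section \<open>Barycentric coordinates on the gasket\<close>

lemma sum_bary: "(\<Sum>i\<in>UNIV. bary a i x) = 1"
  by (simp add: bary_def sum_3 field_simps)

lemma bary_convex_comb:
  "bary a i ((1 - s) *\<^sub>R x + s *\<^sub>R y) = (1 - s) * bary a i x + s * bary a i y"
proof -
  have lin: "(dist z p)\<^sup>2 - (dist z q)\<^sup>2 = p \<bullet> p - q \<bullet> q - 2 * (z \<bullet> (p - q))" for z p q :: "real^2"
    by (simp add: dist_norm power2_norm_eq_inner inner_diff inner_commute)
  show ?thesis
    unfolding bary_def lin by (simp add: sum_3 inner_add_left) argo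
qed

lemma bary_gasket_map: "bary a i (gasket_map a k x) = (bary a i (a k) + bary a i x) / 2"
  using bary_convex_comb[of a i "1/2" "a k" x]
  by (simp add: gasket_map_midpoint scaleR_right_distrib)

lemma continuous_on_bary: "continuous_on A (bary a i)"
  unfolding bary_def by (intro continuous_intros) auto

context
  fixes a :: "3 \<Rightarrow> real^2"
  assumes tri: "unit_triangle a"
begin

lemma bary_vertex: "bary a i (a j) = (if i = j then 1 else 0)"
proof -
  have d: "dist (a i) (a j) = (if i = j then 0 else 1)" for i j
    using tri by (simp add: unit_triangle_def)
  show ?thesis
    unfolding bary_def d using exhaust_3[of i] exhaust_3[of j] by (auto simp: sum_3)
qed

lemma vertex_in_triangle: "a i \<in> triangle a"
  by (auto simp: triangle_def bary_vertex if_distrib[of "\<lambda>c. c *\<^sub>R _"] cong: if_cong)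

lemma gasket_subset_triangle: "gasket a \<subseteq> triangle a"
proof (rule gasket_subset_closed)
  show "closed (triangle a)"
    unfolding triangle_def
    by (intro closed_Collect_conj closed_Collect_all closed_Collect_le closed_Collect_eq
        continuous_intros continuous_on_bary)
  show "gasket_map a i x \<in> triangle a" if "x \<in> triangle a" for i x
  proof -
    have "(\<Sum>j\<in>UNIV. bary a j (gasket_map a i x) *\<^sub>R a j)
        = (1/2) *\<^sub>R ((\<Sum>j\<in>UNIV. bary a j (a i) *\<^sub>R a j) + (\<Sum>j\<in>UNIV. bary a j x *\<^sub>R a j))"
    proof -
      have "((b + c) / 2) *\<^sub>R v = (1/2) *\<^sub>R (b *\<^sub>R v + c *\<^sub>R v)" for b c and v :: "real^2"
        by (simp flip: scaleR_left_distrib)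
      then show ?thesis
        unfolding bary_gasket_map by (simp only: sum.distrib flip: scaleR_sum_right)
    qed
    also have "\<dots> = gasket_map a i x"
      using that vertex_in_triangle[of i] by (simp add: triangle_def gasket_map_midpoint)
    finally show ?thesis
      using that vertex_in_triangle[of i] by (simp add: triangle_def bary_gasket_map)
  qed
qed (auto simp: vertex_in_triangle)

lemma bary_nonneg: "x \<in> gasket a \<Longrightarrow> 0 \<le> bary a i x"
  using gasket_subset_triangle by (auto simp: triangle_def)

lemma sum_bary_scaleR: "x \<in> gasket a \<Longrightarrow> (\<Sum>i\<in>UNIV. bary a i x *\<^sub>R a i) = x"
  using gasket_subset_triangle by (auto simp: triangle_def)

lemma bary_le_1: "x \<in> gasket a \<Longrightarrow> bary a i x \<le> 1"
  using member_le_sum[of i UNIV "\<lambda>i. bary a i x"] by (simp add: sum_bary bary_nonneg)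

lemma gasket_eqI:
  assumes "x \<in> gasket a" "y \<in> gasket a" "\<And>i. bary a i x = bary a i y"
  shows "x = y"
  by (subst (1 2) sum_bary_scaleR[symmetric]) (use assms in auto)

lemma vertex_in_gasket: "a i \<in> gasket a"
  using gasket_V_subset vertex_in_gasket_V by blast

section \<open>Vertices as extreme points, and intersections of cells\<close>

lemma bary_eq_1_imp_vertex:
  assumes "x \<in> gasket a" "bary a i x = 1"
  shows "x = a i"
proof (rule gasket_eqI)
  have "(\<Sum>j\<in>UNIV - {i}. bary a j x) = 0"
    using sum_bary[of a x] assms(2) by (simp add: sum.remove[of _ i])
  then have "\<forall>j\<in>UNIV - {i}. bary a j x = 0"
    using assms(1) by (subst (asm) sum_nonneg_eq_0_iff) (auto simp: bary_nonneg)
  then show "bary a j x = bary a j (a i)" for j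
    using assms(2) by (auto simp: bary_vertex)
qed (use assms vertex_in_gasket in auto)

text \<open>The \<open>j\<close>-th coordinate of the image is the average of two numbers that are
  at most 1, so it equals 1 only if both do.\<close>

lemma gasket_map_eq_vertex:
  assumes "x \<in> gasket a" "gasket_map a i x = a j"
  shows "i = j \<and> x = a j"
proof -
  have "(bary a j (a i) + bary a j x) / 2 = 1"
    using assms(2) bary_gasket_map[of a j i x] by (simp add: bary_vertex)
  moreover have "bary a j x \<le> 1" "bary a j (a i) \<le> 1"
    using assms(1) by (auto intro: bary_le_1 vertex_in_gasket)
  ultimately have "bary a j (a i) = 1" "bary a j x = 1" by auto
  moreover from this have "i = j" by (simp add: bary_vertex split: if_splits)
  ultimately show ?thesis using bary_eq_1_imp_vertex[OF assms(1)] by blast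
qed

lemma gasket_comp_eq_vertex:
  assumes "x \<in> gasket a" "gasket_comp a w x = a j"
  shows "x = a j"
  using assms(2)
proof (induction w)
  case (Cons i w)
  have "i = j \<and> gasket_comp a w x = a j"
    using Cons.prems gasket_comp_in_gasket[OF assms(1)] by (intro gasket_map_eq_vertex) auto
  then show ?case using Cons.IH by blast
qed simp

text \<open>The \<open>j\<close>-th coordinate is at most 1/2 on the \<open>i\<close>-th image and
  at least 1/2 on the \<open>j\<close>-th; a common point has the value 1/2, whence
  \<open>bary a j x = 1\<close>.\<close>

lemma gasket_map_images_meet:
  assumes "x \<in> gasket a" "y \<in> gasket a" "i \<noteq> j" "gasket_map a i x = gasket_map a j y"
  shows "x = a j"
proof (rule bary_eq_1_imp_vertex)
  have "(bary a j (a i) + bary a j x) / 2 = (bary a j (a j) + bary a j y) / 2"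
    by (simp only: bary_gasket_map[symmetric] assms(4))
  then show "bary a j x = 1"
    using assms(3) bary_le_1[OF assms(1), of j] bary_nonneg[OF assms(2), of j]
    by (simp add: bary_vertex)
qed (rule assms(1))

text \<open>A common prefix is removed by injectivity. At the first differing letter the remaining
  word sends \<open>x\<close> to a vertex, and only that vertex itself can be sent there.\<close>

lemma cells_meet:
  assumes "length w = length w'" "w \<noteq> w'" "x \<in> gasket a" "y \<in> gasket a"
    "gasket_comp a w x = gasket_comp a w' y"
  shows "x \<in> range a"
  using assms
proof (induction w w' rule: list_induct2)
  case (Cons i w j w')
  show ?case
  proof (cases "i = j")
    case True
    with Cons show ?thesis by simp
  next
    case False
    then have "gasket_comp a w x = a j"
      using Cons.prems by (intro gasket_map_images_meet[of _ "gasket_comp a w' y" i j])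
        (auto intro: gasket_comp_in_gasket)
    then show ?thesis using gasket_comp_eq_vertex[OF \<open>x \<in> gasket a\<close>] by blast
  qed
qed simp

text \<open>This recognises the points of \<open>gasket_V a n\<close> on a curve as corners of the
  cell the curve is in. If the two words differ, the cells meet there; if they agree, the scaling of
  distances gives injectivity.\<close>

lemma gasket_V_cell:
  assumes "x \<in> gasket a" "gasket_comp a w x \<in> gasket_V a (length w)"
  shows "x \<in> range a"
proof -
  obtain w' k where "length w' = length w" "gasket_comp a w x = gasket_comp a w' (a k)"
    using assms(2) by (auto simp: gasket_V_def)
  then show ?thesis
    using cells_meet[of w w' x "a k"] assms(1) vertex_in_gasket dist_gasket_comp[of a w x "a k"]
      mesh_pos[of "length w"] by (cases "w = w'") auto
qed

lemma dist_vertex_le_1: "x \<in> gasket a \<Longrightarrow> dist (a i) x \<le> 1"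
proof -
  assume x: "x \<in> gasket a"
  have "(\<Sum>j\<in>UNIV. bary a j x *\<^sub>R (a i - a j)) = a i - x"
    using sum_bary_scaleR[OF x] sum_bary[of a x]
    by (simp add: scaleR_diff_right sum_subtractf flip: scaleR_left.sum)
  then have "dist (a i) x = norm (\<Sum>j\<in>UNIV. bary a j x *\<^sub>R (a i - a j))"
    by (simp add: dist_norm)
  also have "\<dots> \<le> (\<Sum>j\<in>UNIV. norm (bary a j x *\<^sub>R (a i - a j)))" by (rule norm_sum)
  also have "\<dots> \<le> (\<Sum>j\<in>UNIV. bary a j x)"
  proof (rule sum_mono)
    fix j
    have "norm (a i - a j) \<le> 1"
      using tri by (cases "i = j") (auto simp: unit_triangle_def dist_norm)
    then show "norm (bary a j x *\<^sub>R (a i - a j)) \<le> bary a j x"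
      using bary_nonneg[OF x, of j] by (simp add: mult_left_le)
  qed
  finally show ?thesis by (simp add: sum_bary)
qed

lemma compact_gasket: "compact (gasket a)"
  using dist_vertex_le_1 closed_gasket
  by (auto simp: compact_eq_bounded_closed bounded_def)

lemma gasket_eq_UN_map: "gasket a = (\<Union>i. gasket_map a i ` gasket a)"
proof
  have "closed (gasket_map a i ` gasket a)" for i
    by (intro compact_imp_closed compact_continuous_image continuous_on_gasket_map compact_gasket)
  then have "closed (\<Union>i. gasket_map a i ` gasket a)" by (intro closed_UN) auto
  moreover have "gasket_V a n \<subseteq> (\<Union>i. gasket_map a i ` gasket a)" for n
    using gasket_V_mono_Suc[of a n] unfolding gasket_V_Suc
    by (rule order_trans) (intro UN_mono image_mono gasket_V_subset order_refl)
  ultimately show "gasket a \<subseteq> (\<Union>i. gasket_map a i ` gasket a)"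
    by (subst gasket_def) (intro closure_minimal, auto)
qed (auto intro: gasket_map_in_gasket)

lemma gasket_eq_UN_cell: "gasket a = (\<Union>w\<in>{w. length w = n}. cell a w)"
proof
  show "gasket a \<subseteq> (\<Union>w\<in>{w. length w = n}. cell a w)"
  proof (induction n)
    case (Suc n)
    show ?case
    proof
      fix x assume "x \<in> gasket a"
      then obtain i y where "x = gasket_map a i y" "y \<in> gasket a" using gasket_eq_UN_map by blast
      moreover then obtain w z where "length w = n" "z \<in> gasket a" "y = gasket_comp a w z"
        using Suc by blast
      ultimately have "x = gasket_comp a (i # w) z" "length (i # w) = Suc n" "z \<in> gasket a" by auto
      then show "x \<in> (\<Union>w\<in>{w. length w = Suc n}. cell a w)" by blast
    qed
  qed (simp add: image_def)
qed (auto intro: gasket_comp_in_gasket)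

lemma closed_cell: "closed (cell a w)"
  by (intro compact_imp_closed compact_continuous_image continuous_on_gasket_comp compact_gasket)

section \<open>Edges of the prefractal graphs\<close>

lemma gasket_adj_corners:
  assumes "length w = n" "i \<noteq> j"
  shows "gasket_adj a n (gasket_comp a w (a i)) (gasket_comp a w (a j))"
  using assms by (auto simp: gasket_adj_def gasket_V_def gasket_comp_segment)

text \<open>A segment determines its unordered pair of end points; the two possible orders are
  absorbed by exchanging \<open>i\<close> and \<open>j\<close>.\<close>

lemma gasket_adj_cases:
  assumes "gasket_adj a n x y"
  obtains w i j where "length w = n" "i \<noteq> j" "x = gasket_comp a w (a i)" "y = gasket_comp a w (a j)"
proof -
  obtain w i j where "length w = n" "i \<noteq> j"
    "closed_segment x y = closed_segment (gasket_comp a w (a i)) (gasket_comp a w (a j))"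
    using assms by (auto simp: gasket_adj_def gasket_comp_segment)
  then show ?thesis using that[of w i j] that[of w j i] by (auto simp: doubleton_eq_iff)
qed

lemma gasket_adj_sym: "gasket_adj a n x y \<Longrightarrow> gasket_adj a n y x"
  by (auto elim!: gasket_adj_cases intro: gasket_adj_corners)

lemma gasket_adj_dist: "gasket_adj a n x y \<Longrightarrow> dist x y = mesh n"
  using tri by (auto elim!: gasket_adj_cases simp: dist_gasket_comp unit_triangle_def)

text \<open>A side is covered by its own images under the two maps fixing its ends, which meet at
  the midpoint. Iterating this, each of its points is within \<open>mesh n\<close> of
  \<open>gasket_V a n\<close>, and the gasket is closed.\<close>

lemma side_subset_gasket: "closed_segment (a i) (a j) \<subseteq> gasket a"
proof
  fix z assume z: "z \<in> closed_segment (a i) (a j)"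
  have approx: "\<exists>v\<in>gasket_V a n. dist z v \<le> mesh n" if "z \<in> closed_segment (a i) (a j)" for n z
    using that
  proof (induction n arbitrary: z)
    case 0
    have "dist z (a i) \<le> dist (a j) (a i)"
      using 0 by (metis dist_commute dist_in_closed_segment(1))
    also have "\<dots> \<le> 1" by (rule dist_vertex_le_1[OF vertex_in_gasket, of j i])
    finally show ?case by (auto simp: gasket_V_0 mesh_def)
  next
    case (Suc n)
    have "closed_segment (a i) (a j)
        \<subseteq> gasket_map a i ` closed_segment (a i) (a j) \<union> gasket_map a j ` closed_segment (a i) (a j)"
    proof -
      have "midpoint (a i) (a j) \<in> closed_segment (a i) (a j)" by simp
      then have "closed_segment (a i) (a j)
          \<subseteq> closed_segment (a i) (midpoint (a i) (a j)) \<union> closed_segment (midpoint (a i) (a j)) (a j)"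
        using Un_closed_segment by blast
      moreover have "gasket_map a i (a j) = midpoint (a i) (a j)"
        "gasket_map a j (a i) = midpoint (a i) (a j)"
        by (simp_all add: gasket_map_midpoint midpoint_def inverse_eq_divide add.commute)
      ultimately show ?thesis by (simp add: gasket_map_segment)
    qed
    with Suc.prems obtain k y where y: "z = gasket_map a k y" "y \<in> closed_segment (a i) (a j)"
      by blast
    then obtain v where "v \<in> gasket_V a n" "dist y v \<le> mesh n" using Suc.IH by blast
    then have "gasket_map a k v \<in> gasket_V a (Suc n)" "dist z (gasket_map a k v) \<le> mesh (Suc n)"
      by (auto simp: gasket_V_Suc y dist_gasket_map mesh_def)
    then show ?case by blast
  qed
  show "z \<in> gasket a"
    unfolding gasket_def closure_approachable
  proof (intro allI impI)
    fix e :: real assume "e > 0"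
    then have "\<forall>\<^sub>F n in sequentially. mesh n < e" by (rule order_tendstoD(2)[OF mesh_tendsto_0])
    then obtain n where "mesh n < e" by (auto simp: eventually_sequentially)
    with approx[OF z, of n] show "\<exists>y\<in>\<Union> (range (gasket_V a)). dist y z < e"
      by (metis UN_I UNIV_I dist_commute order_le_less_trans)
  qed
qed

lemma gasket_adj_segment_subset: "gasket_adj a n x y \<Longrightarrow> closed_segment x y \<subseteq> gasket a"
  using side_subset_gasket gasket_comp_in_gasket
  by (force elim!: gasket_adj_cases simp flip: gasket_comp_segment)

text \<open>Extremality again: a weighted average of coordinates at most 1 equals 1 only if both do.
  Consequently the interior of an edge avoids \<Gamma>, and the subsolution test is available
  there.\<close>

lemma vertex_not_in_open_segment:
  assumes "x \<in> gasket a" "y \<in> gasket a" "0 < s" "s < 1" "(1 - s) *\<^sub>R x + s *\<^sub>R y = a i"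
  shows "x = y"
proof -
  have *: "(1 - s) * (1 - bary a i x) + s * (1 - bary a i y) = 0"
  proof -
    have "bary a i ((1 - s) *\<^sub>R x + s *\<^sub>R y) = 1" by (simp add: assms(5) bary_vertex)
    then show ?thesis unfolding bary_convex_comb by (simp add: algebra_simps)
  qed
  have "0 \<le> (1 - s) * (1 - bary a i x)" "0 \<le> s * (1 - bary a i y)"
    using assms(3,4) bary_le_1[OF assms(1)] bary_le_1[OF assms(2)] by auto
  with * have "(1 - s) * (1 - bary a i x) = 0" "s * (1 - bary a i y) = 0" by linarith+
  then have "bary a i x = 1" "bary a i y = 1" using assms(3,4) by auto
  then show ?thesis using bary_eq_1_imp_vertex assms(1,2) by metis
qed

end

section \<open>Curves in the gasket\<close>

lemma lipschitz_on_affine_reparam: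
  fixes \<gamma> :: "real \<Rightarrow> 'a::metric_space"
  assumes "L-lipschitz_on B \<gamma>" "\<And>t. t \<in> A \<Longrightarrow> b + c * t \<in> B"
  shows "(L * \<bar>c\<bar>)-lipschitz_on A (\<lambda>t. \<gamma> (b + c * t))"
proof (rule lipschitz_onI)
  fix s t assume "s \<in> A" "t \<in> A"
  then have "dist (\<gamma> (b + c * s)) (\<gamma> (b + c * t)) \<le> L * dist (b + c * s) (b + c * t)"
    using assms by (intro lipschitz_onD[OF assms(1)]) auto
  also have "dist (b + c * s) (b + c * t) = \<bar>c\<bar> * dist s t"
    by (simp add: dist_real_def flip: right_diff_distrib) (simp add: abs_mult)
  finally show "dist (\<gamma> (b + c * s)) (\<gamma> (b + c * t)) \<le> L * \<bar>c\<bar> * dist s t" by simp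
qed (simp add: lipschitz_on_nonneg[OF assms(1)])

lemma curve_length_le_lipschitz:
  assumes "L-lipschitz_on {0..1} \<gamma>"
  shows "curve_length \<gamma> \<le> ereal L"
  unfolding curve_length_def
proof (rule SUP_least)
  fix ts :: "real list" assume "ts \<in> {ts. sorted ts \<and> set ts \<subseteq> {0..1}}"
  then have ts: "sorted ts" "set ts \<subseteq> {0..1}" by auto
  have L: "0 \<le> L" using assms by (rule lipschitz_on_nonneg)
  have "(\<Sum>i<length ts - 1. dist (\<gamma> (ts ! i)) (\<gamma> (ts ! Suc i)))
      \<le> (\<Sum>i<length ts - 1. L * (ts ! Suc i - ts ! i))"
  proof (rule sum_mono)
    fix i assume i: "i \<in> {..<length ts - 1}"
    then have "ts ! i \<in> set ts" "ts ! Suc i \<in> set ts" by (auto intro!: nth_mem)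
    then have "ts ! i \<in> {0..1}" "ts ! Suc i \<in> {0..1}" using ts(2) by blast+
    moreover have "ts ! i \<le> ts ! Suc i" using ts(1) i by (auto intro: sorted_nth_mono)
    ultimately show "dist (\<gamma> (ts ! i)) (\<gamma> (ts ! Suc i)) \<le> L * (ts ! Suc i - ts ! i)"
      using lipschitz_onD[OF assms, of "ts ! i" "ts ! Suc i"] by (simp add: dist_real_def)
  qed
  also have "\<dots> = L * (ts ! (length ts - 1) - ts ! 0)"
    by (simp add: sum_lessThan_telescope flip: sum_distrib_left)
  also have "\<dots> \<le> L"
  proof (cases "ts = []")
    case False
    then have "ts ! (length ts - 1) \<in> set ts" "ts ! 0 \<in> set ts" by (auto intro!: nth_mem)
    then have "ts ! (length ts - 1) \<in> {0..1}" "ts ! 0 \<in> {0..1}" using ts(2) by blast+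
    then show ?thesis using L by (intro mult_left_le) auto
  qed (use L in simp)
  finally show "ereal (\<Sum>i<length ts - 1. dist (\<gamma> (ts ! i)) (\<gamma> (ts ! Suc i))) \<le> ereal L"
    by simp
qed

lemma dist_le_curve_length: "ereal (dist (\<gamma> 0) (\<gamma> 1)) \<le> curve_length \<gamma>"
  unfolding curve_length_def by (rule SUP_upper2[of "[0, 1]"]) auto

text \<open>The given path serves both bounds: without a path of finite length the infimum would be
  infinite, \<open>real_of_ereal\<close> would return 0, and the lower bound could fail.\<close>

lemma geodesic_dist_bounds:
  fixes \<gamma> :: "real \<Rightarrow> 'a::metric_space"
  assumes "L-lipschitz_on {0..1} \<gamma>" "\<gamma> ` {0..1} \<subseteq> X" "\<gamma> 0 = x" "\<gamma> 1 = y"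
  shows "dist x y \<le> geodesic_dist X x y" "geodesic_dist X x y \<le> L"
proof -
  define P where "P = {\<gamma>. path \<gamma> \<and> path_image \<gamma> \<subseteq> X \<and> pathstart \<gamma> = x \<and> pathfinish \<gamma> = y}"
  define I where "I = (INF \<gamma>\<in>P. curve_length \<gamma>)"
  have "\<gamma> \<in> P"
    using assms lipschitz_on_continuous_on[OF assms(1)]
    by (auto simp: P_def path_def path_image_def pathstart_def pathfinish_def)
  then have "I \<le> ereal L"
    unfolding I_def
    using curve_length_le_lipschitz[OF assms(1)] by (intro INF_lower2[of \<gamma>])
  moreover have "ereal (dist x y) \<le> I"
    unfolding I_def
  proof (rule INF_greatest)
    fix \<eta> assume "\<eta> \<in> P"
    then show "ereal (dist x y) \<le> curve_length \<eta>"
      using dist_le_curve_length[of \<eta>] by (auto simp: P_def pathstart_def pathfinish_def)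
  qed
  ultimately have "ereal (dist x y) \<le> I \<and> I \<le> ereal L" by simp
  then have "dist x y \<le> real_of_ereal I \<and> real_of_ereal I \<le> L"
    by (cases I) auto
  then show "dist x y \<le> geodesic_dist X x y" "geodesic_dist X x y \<le> L"
    by (simp_all add: geodesic_dist_def I_def P_def)
qed

lemma dist_linepath:
  fixes x y :: "'a::real_normed_vector"
  shows "dist (linepath x y s) (linepath x y t) = dist x y * \<bar>s - t\<bar>"
proof -
  have "linepath x y s - linepath x y t = (t - s) *\<^sub>R (x - y)"
    by (simp add: linepath_def algebra_simps)
  then show ?thesis by (simp add: dist_norm abs_minus_commute)
qed

lemma geodesic_dist_segment:
  fixes x y :: "'a::real_normed_vector"
  assumes "closed_segment x y \<subseteq> X"
  shows "geodesic_dist X x y = dist x y"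
proof -
  have "(dist x y)-lipschitz_on {0..1} (linepath x y)"
    by (intro lipschitz_onI) (simp_all add: dist_linepath dist_real_def)
  then show ?thesis
    using geodesic_dist_bounds[of "dist x y" "linepath x y" X x y] assms
    by (simp add: path_image_def[symmetric] linepath_0' linepath_1' antisym)
qed

text \<open>Segments between points of the curve lie in \<open>X\<close>, so all metric quotients
  are exactly 1. Absence of isolated points in \<open>I\<close> makes the filter in
  \<open>metric_deriv\<close> nontrivial, so that \<open>Lim\<close> returns this value.\<close>

lemma unit_speed_segment_admissible:
  fixes p e :: "'a::real_normed_vector"
  assumes "is_interval I" and lim: "\<And>t. t \<in> I \<Longrightarrow> t islimpt I" and "norm e = 1"
    and sub: "\<And>t. t \<in> I \<Longrightarrow> p + t *\<^sub>R e \<in> X"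
  shows "admissible (geodesic_dist X) X I (\<lambda>t. p + t *\<^sub>R e)"
proof -
  let ?d = "geodesic_dist X" and ?\<xi> = "\<lambda>t. p + t *\<^sub>R e"
  have d: "?d (?\<xi> s) (?\<xi> t) = \<bar>s - t\<bar>" if "s \<in> I" "t \<in> I" for s t
  proof -
    have "closed_segment (?\<xi> s) (?\<xi> t) \<subseteq> X"
    proof
      fix z assume "z \<in> closed_segment (?\<xi> s) (?\<xi> t)"
      then obtain u where u: "0 \<le> u" "u \<le> 1" "z = (1 - u) *\<^sub>R ?\<xi> s + u *\<^sub>R ?\<xi> t"
        by (auto simp: closed_segment_def)
      have "(1 - u) * s + u * t \<in> I"
        using that u assms(1) convexD[of I s t "1 - u" u] by (simp add: is_interval_convex_1)
      then have "?\<xi> ((1 - u) * s + u * t) \<in> X" by (rule sub)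
      moreover have "?\<xi> ((1 - u) * s + u * t) = z" by (simp add: u(3) algebra_simps)
      ultimately show "z \<in> X" by simp
    qed
    then have "?d (?\<xi> s) (?\<xi> t) = dist (?\<xi> s) (?\<xi> t)" by (rule geodesic_dist_segment)
    also have "\<dots> = \<bar>s - t\<bar>"
      using assms(3) by (simp add: dist_norm flip: scaleR_left_diff_distrib)
    finally show ?thesis .
  qed
  have q: "(metric_quot ?d ?\<xi> t \<longlongrightarrow> 1) (at t within I)" if "t \<in> I" for t
  proof (rule tendsto_eventually)
    show "\<forall>\<^sub>F s in at t within I. metric_quot ?d ?\<xi> t s = 1"
      using that by (auto simp: eventually_at_filter metric_quot_def d)
  qed
  then have D: "metric_deriv ?d I ?\<xi> t = 1" if "t \<in> I" for t
    unfolding metric_deriv_def using that lim[OF that] by (intro tendsto_Lim) (auto simp: trivial_limit_within)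
  have int: "set_integrable lebesgue K (metric_deriv ?d I ?\<xi>)" if "compact K" "K \<subseteq> I" for K
  proof -
    have "set_integrable lebesgue K (\<lambda>_. 1 :: real)"
      using that lmeasurable_compact by (simp add: set_integrable_def flip: lmeasurable_iff_integrable)
    moreover have "set_integrable lebesgue K (metric_deriv ?d I ?\<xi>) \<longleftrightarrow> set_integrable lebesgue K (\<lambda>_. 1 :: real)"
      using that D by (intro set_integrable_cong) auto
    ultimately show ?thesis by simp
  qed
  have le: "?d (?\<xi> s) (?\<xi> t) \<le> set_lebesgue_integral lebesgue {s..t} (metric_deriv ?d I ?\<xi>)"
    if "s \<in> I" "t \<in> I" "s \<le> t" for s t
  proof -
    have "{s..t} \<subseteq> I" by (rule subsetI, rule mem_is_interval_1_I[OF assms(1) that(1,2)]) auto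
    then have "set_lebesgue_integral lebesgue {s..t} (metric_deriv ?d I ?\<xi>)
        = set_lebesgue_integral lebesgue {s..t} (\<lambda>_. 1)"
      using D by (intro set_lebesgue_integral_cong) auto
    also have "\<dots> = t - s" using that by (simp add: set_lebesgue_integral_def)
    finally show ?thesis using d[OF that(1,2)] that(3) by simp
  qed
  show ?thesis
    unfolding admissible_def abs_cont_curve_def
    using assms(1) sub q D int le by (intro conjI AE_I2 allI ballI impI) auto
qed

context
  fixes a :: "3 \<Rightarrow> real^2"
  assumes tri: "unit_triangle a"
begin

text \<open>
  The union of the cells at \<open>v\<close> meets the other cells only in vertices different from \<open>v\<close>, so a
  curve leaves it through a neighbour of \<open>v\<close>.
\<close>
lemma curve_reaches_neighbour:
  fixes \<xi> :: "real \<Rightarrow> real^2"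
  assumes cont: "continuous_on {s..T} \<xi>" and sub: "\<xi> ` {s..T} \<subseteq> gasket a" and "s \<le> T"
    and v: "\<xi> s \<in> gasket_V a n" and "\<xi> T \<in> gasket_V a n" "\<xi> T \<noteq> \<xi> s"
  obtains t where "s < t" "t \<le> T" "gasket_adj a n (\<xi> s) (\<xi> t)"
    "\<And>r. r \<in> {s..t} \<Longrightarrow> dist (\<xi> s) (\<xi> r) \<le> mesh n"
proof -
  define v where "v = \<xi> s"
  define Z where "Z = {s..T} \<inter> \<xi> -` (gasket_V a n - {v})"
  have Z: "closed Z" unfolding Z_def
    by (intro continuous_closed_preimage cont finite_imp_closed[OF finite_Diff] finite_gasket_V) simp
  have "T \<in> Z" using assms by (auto simp: Z_def v_def)
  have bdd: "bdd_below Z" by (auto simp: Z_def intro: bdd_belowI[of _ s])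
  define t where "t = Inf Z"
  have tZ: "t \<in> Z" unfolding t_def using \<open>T \<in> Z\<close> bdd Z by (intro closed_contains_Inf) auto
  have before: "\<xi> r \<notin> gasket_V a n - {v}" if "r \<in> {s..<t}" for r
  proof
    assume "\<xi> r \<in> gasket_V a n - {v}"
    then have "r \<in> Z" using that tZ by (auto simp: Z_def)
    then have "t \<le> r" unfolding t_def using bdd by (rule cInf_lower)
    then show False using that by simp
  qed
  have st: "s < t" "t \<le> T" using tZ by (auto simp: Z_def v_def less_le)
  define A where "A = (\<Union>w\<in>{w. length w = n \<and> v \<in> cell a w}. cell a w)"
  define B where "B = (\<Union>w\<in>{w. length w = n \<and> v \<notin> cell a w}. cell a w)"
  have fin: "finite {w :: 3 list. length w = n \<and> Q w}" for Q
    using finite_lists_length_eq[of "UNIV :: 3 set" n] by simp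
  have closed: "closed A" "closed B"
    unfolding A_def B_def by (intro closed_UN fin ballI closed_cell tri)+
  have "{w :: 3 list. length w = n} = {w. length w = n \<and> Q w} \<union> {w. length w = n \<and> \<not> Q w}" for Q
    by blast
  from this[of "\<lambda>w. v \<in> cell a w"] have "gasket a = A \<union> B"
    using gasket_eq_UN_cell[OF tri, of n] by (simp only: A_def B_def UN_Un)
  have AB: "z \<in> gasket_V a n - {v}" if zA: "z \<in> A" and zB: "z \<in> B" for z
  proof -
    obtain w x where w: "length w = n" "v \<in> cell a w" "x \<in> gasket a" "z = gasket_comp a w x"
      using zA unfolding A_def by blast
    obtain w' y where w': "length w' = n" "v \<notin> cell a w'" "y \<in> gasket a" "z = gasket_comp a w' y"
      using zB unfolding B_def by blast
    have "x \<in> range a" using cells_meet[OF tri, of w w' x y] w w' by auto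
    then have "z \<in> gasket_V a n" using w by (auto simp: gasket_V_def)
    moreover have "z \<noteq> v" using w' by auto
    ultimately show ?thesis by simp
  qed
  \<comment> \<open>The half-open interval is essential: before \<open>t\<close> no vertex other
    than \<open>v\<close> is met, so the curve avoids \<open>A \<inter> B\<close> and connectedness
    keeps it in \<open>A\<close>. Closedness of \<open>A\<close> then adds the time
    \<open>t\<close>.\<close>
  have "connected (\<xi> ` {s..<t})"
    using st by (intro connected_continuous_image continuous_on_subset[OF cont]) auto
  moreover have "\<xi> ` {s..<t} \<subseteq> A \<union> B" using sub st \<open>gasket a = A \<union> B\<close> by force
  moreover have "A \<inter> B \<inter> \<xi> ` {s..<t} = {}" using AB before by blast
  moreover have "v \<in> A"
    using v gasket_V_subset[of a n] vertex_in_gasket[OF tri] by (auto simp: A_def v_def gasket_V_def)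
  then have "A \<inter> \<xi> ` {s..<t} \<noteq> {}" using st by (auto simp: v_def)
  ultimately have "B \<inter> \<xi> ` {s..<t} = {}" using closed by (auto simp: connected_closed)
  then have "\<xi> ` {s..<t} \<subseteq> A" using \<open>\<xi> ` {s..<t} \<subseteq> A \<union> B\<close> by blast
  moreover have "closure {s..<t} = {s..t}" using st by simp
  moreover have "continuous_on {s..t} \<xi>" using st by (intro continuous_on_subset[OF cont]) auto
  ultimately have inA: "\<xi> ` {s..t} \<subseteq> A"
    using image_closure_subset[of "{s..<t}" \<xi> A] closed by simp
  have A: "\<exists>w i y. length w = n \<and> y \<in> gasket a \<and> v = gasket_comp a w (a i) \<and> z = gasket_comp a w y"
    if zA: "z \<in> A" for z
  proof -
    obtain w x y where w: "length w = n" "x \<in> gasket a" "v = gasket_comp a w x"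
      "y \<in> gasket a" "z = gasket_comp a w y"
      using zA unfolding A_def by blast
    then obtain i where "x = a i" using gasket_V_cell[OF tri, of x w] v by (auto simp: v_def)
    with w show ?thesis by blast
  qed
  show ?thesis
  proof (rule that[OF st])
    obtain w i y where w: "length w = n" "y \<in> gasket a" "v = gasket_comp a w (a i)" "\<xi> t = gasket_comp a w y"
      using A[of "\<xi> t"] inA st by (meson atLeastAtMost_iff image_subset_iff less_imp_le order_refl)
    have "\<xi> t \<in> gasket_V a n" "\<xi> t \<noteq> v" using tZ by (auto simp: Z_def)
    then obtain j where "y = a j" using gasket_V_cell[OF tri, of y w] w by auto
    then show "gasket_adj a n (\<xi> s) (\<xi> t)"
      using w gasket_adj_corners[OF tri, of w n i j] \<open>\<xi> t \<noteq> v\<close> by (auto simp: v_def)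
    fix r assume "r \<in> {s..t}"
    then obtain w i y where w: "length w = n" "y \<in> gasket a" "v = gasket_comp a w (a i)" "\<xi> r = gasket_comp a w y"
      using A[of "\<xi> r"] inA by blast
    then show "dist (\<xi> s) (\<xi> r) \<le> mesh n"
      using dist_vertex_le_1[OF tri, of y i] mesh_pos[of n]
      by (simp add: dist_gasket_comp mult_left_le flip: v_def)
  qed
qed

text \<open>For \<open>x = gasket_map a i y\<close>, the image of a path from \<open>y\<close> to
  \<open>a k\<close> has half the length and ends at
  \<open>gasket_map a i (a k) = gasket_map a k (a i)\<close>, from where half a side leads to
  \<open>a k\<close>. Since 1/2 + 1/2 = 1, the constant does not grow with \<open>n\<close>.\<close>

lemma lipschitz_path_from_gasket_V:
  "x \<in> gasket_V a n \<Longrightarrow>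
    \<exists>\<gamma>. 1-lipschitz_on {0..1} \<gamma> \<and> \<gamma> ` {0..1::real} \<subseteq> gasket a \<and> \<gamma> 0 = x \<and> \<gamma> 1 = a k"
proof (induction n arbitrary: x)
  case 0
  then obtain i where i: "x = a i" by (auto simp: gasket_V_0)
  have "dist (a i) (a k) \<le> 1" using dist_vertex_le_1[OF tri vertex_in_gasket[OF tri]] .
  then have "1-lipschitz_on {0..1} (linepath (a i) (a k))"
    by (intro lipschitz_onI) (auto simp: dist_linepath dist_real_def mult_left_le_one_le)
  then show ?case
    using side_subset_gasket[OF tri, of i k] i
    by (intro exI[of _ "linepath (a i) (a k)"]) (simp add: path_image_def[symmetric] linepath_0' linepath_1')
next
  case (Suc n)
  then obtain i y where y: "x = gasket_map a i y" "y \<in> gasket_V a n" by (auto simp: gasket_V_Suc)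
  then obtain \<gamma> where \<gamma>: "1-lipschitz_on {0..1} \<gamma>" "\<gamma> ` {0..1::real} \<subseteq> gasket a" "\<gamma> 0 = y" "\<gamma> 1 = a k"
    using Suc.IH by blast
  define l where "l = linepath (gasket_map a k (a i)) (a k)"
  define \<eta> where "\<eta> t = (if t \<le> 1/2 then gasket_map a i (\<gamma> (2 * t)) else l (2 * t - 1))" for t
  have 1: "1-lipschitz_on {0..1/2} (\<lambda>t. gasket_map a i (\<gamma> (2 * t)))"
  proof (rule lipschitz_onI)
    fix s t :: real assume st: "s \<in> {0..1/2}" "t \<in> {0..1/2}"
    have "2-lipschitz_on {0..1/2} (\<lambda>t. \<gamma> (2 * t))"
      using lipschitz_on_affine_reparam[OF \<gamma>(1), of "{0..1/2}" 0 2] by simp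
    from lipschitz_onD[OF this st]
    show "dist (gasket_map a i (\<gamma> (2 * s))) (gasket_map a i (\<gamma> (2 * t))) \<le> 1 * dist s t"
      by (simp add: dist_gasket_map)
  qed simp
  have half: "dist (gasket_map a k (a i)) (a k) \<le> 1/2"
    using dist_gasket_map[of a k "a i" "a k"] dist_vertex_le_1[OF tri vertex_in_gasket[OF tri], of i k] by simp
  have "dist (l (2 * s - 1)) (l (2 * t - 1)) \<le> 1 * dist s t" for s t
  proof -
    have "\<bar>(2 * s - 1) - (2 * t - 1)\<bar> = 2 * \<bar>s - t\<bar>" by (simp add: abs_if)
    moreover have "dist (gasket_map a k (a i)) (a k) * (2 * \<bar>s - t\<bar>) \<le> 1/2 * (2 * \<bar>s - t\<bar>)"
      using half by (intro mult_right_mono) auto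
    ultimately show ?thesis by (simp add: l_def dist_linepath dist_real_def)
  qed
  then have 2: "1-lipschitz_on {1/2..1} (\<lambda>t. l (2 * t - 1))" by (intro lipschitz_onI) auto
  have "1-lipschitz_on {0..1} \<eta>"
    unfolding \<eta>_def using 1 2
    by (intro lipschitz_on_concat) (auto simp: l_def linepath_0' \<gamma> gasket_map_swap)
  moreover have "closed_segment (gasket_map a k (a i)) (a k) \<subseteq> gasket a"
    using side_subset_gasket[OF tri, of i k] gasket_map_segment[of a k "a i" "a k"]
    by (force simp: gasket_map_in_gasket)
  then have "l ` {0..1} \<subseteq> gasket a" unfolding l_def by (simp add: path_image_def[symmetric])
  then have "\<eta> ` {0..1} \<subseteq> gasket a"
    using \<gamma>(2) by (auto simp: \<eta>_def image_subset_iff gasket_map_in_gasket)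
  moreover have "\<eta> 0 = x" "\<eta> 1 = a k" using y \<gamma> by (auto simp: \<eta>_def l_def linepath_1')
  ultimately show ?case by blast
qed

text \<open>As the Lipschitz constant is the same at all levels, Arzela-Ascoli yields a limit of
  paths from approximating points of the vertex sets, and the bound, the end points and the
  inclusion in the closed gasket survive.\<close>

lemma lipschitz_path_to_vertex:
  assumes "x \<in> gasket a"
  shows "\<exists>\<gamma>. 1-lipschitz_on {0..1} \<gamma> \<and> \<gamma> ` {0..1::real} \<subseteq> gasket a \<and> \<gamma> 0 = x \<and> \<gamma> 1 = a k"
proof -
  obtain X where X: "\<And>n. X n \<in> (\<Union>n. gasket_V a n)" "X \<longlonglongrightarrow> x"
    using assms unfolding gasket_def closure_sequential by blast
  have "\<exists>\<gamma>. 1-lipschitz_on {0..1} \<gamma> \<and> \<gamma> ` {0..1::real} \<subseteq> gasket a \<and> \<gamma> 0 = X n \<and> \<gamma> 1 = a k" for n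
    using X(1)[of n] lipschitz_path_from_gasket_V by blast
  then obtain \<gamma> :: "nat \<Rightarrow> real \<Rightarrow> real^2" where \<gamma>: "\<And>n. 1-lipschitz_on {0..1} (\<gamma> n)"
    "\<And>n. \<gamma> n ` {0..1} \<subseteq> gasket a" "\<And>n. \<gamma> n 0 = X n" "\<And>n. \<gamma> n 1 = a k"
    by metis
  obtain M where M: "\<And>z. z \<in> gasket a \<Longrightarrow> norm z \<le> M"
    using compact_gasket[OF tri] by (metis bounded_iff compact_imp_bounded)
  obtain \<eta> and r :: "nat \<Rightarrow> nat" where r: "strict_mono r"
    and unif: "\<And>e. 0 < e \<Longrightarrow> \<exists>N. \<forall>n t. n \<ge> N \<and> t \<in> {0..1} \<longrightarrow> norm (\<gamma> (r n) t - \<eta> t) < e"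
  proof (rule Arzela_Ascoli[of "{0..1}" \<gamma> M])
    show "norm (\<gamma> n t) \<le> M" if "t \<in> {0..1}" for n t
      using \<gamma>(2)[of n] that by (intro M) blast
    show "\<exists>d>0. \<forall>n s. s \<in> {0..1} \<and> norm (t - s) < d \<longrightarrow> norm (\<gamma> n t - \<gamma> n s) < e"
      if "t \<in> {0..1}" "0 < e" for t e
      using lipschitz_onD[OF \<gamma>(1) that(1)] that(2)
      by (intro exI[of _ e]) (auto simp: dist_norm intro: order_le_less_trans)
  qed auto
  have lim: "(\<lambda>n. \<gamma> (r n) t) \<longlonglongrightarrow> \<eta> t" if "t \<in> {0..1}" for t
    unfolding LIMSEQ_iff using unif that by blast
  have "1-lipschitz_on {0..1} \<eta>"
  proof (rule lipschitz_onI)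
    fix s t :: real assume st: "s \<in> {0..1}" "t \<in> {0..1}"
    have "(\<lambda>n. dist (\<gamma> (r n) s) (\<gamma> (r n) t)) \<longlonglongrightarrow> dist (\<eta> s) (\<eta> t)"
      using lim st by (intro tendsto_dist)
    then show "dist (\<eta> s) (\<eta> t) \<le> 1 * dist s t"
      by (rule LIMSEQ_le_const2) (use lipschitz_onD[OF \<gamma>(1) st] in blast)
  qed simp
  moreover have "\<eta> ` {0..1} \<subseteq> gasket a"
  proof
    fix z assume "z \<in> \<eta> ` {0..1}"
    then obtain t where t: "t \<in> {0..1}" "z = \<eta> t" by auto
    then have "\<gamma> (r n) t \<in> gasket a" for n using \<gamma>(2)[of "r n"] by blast
    then show "z \<in> gasket a"
      using closed_sequentially[OF closed_gasket _ lim[OF t(1)]] t(2) by blast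
  qed
  moreover have "\<eta> 0 = x"
    using lim[of 0] LIMSEQ_subseq_LIMSEQ[OF X(2) r] \<gamma>(3) by (simp add: LIMSEQ_unique o_def)
  moreover have "\<eta> 1 = a k"
    using lim[of 1] \<gamma>(4) by (simp add: LIMSEQ_const_iff)
  ultimately show ?thesis by blast
qed

text \<open>Two paths to the vertex \<open>a 1\<close>, the second one reversed, give the path of
  finite length that makes the geodesic infimum finite.\<close>

lemma dist_le_gasket_dist:
  assumes "x \<in> gasket a" "y \<in> gasket a"
  shows "dist x y \<le> gasket_dist a x y"
proof -
  obtain \<gamma> where \<gamma>: "1-lipschitz_on {0..1} \<gamma>" "\<gamma> ` {0..1::real} \<subseteq> gasket a" "\<gamma> 0 = x" "\<gamma> 1 = a 1"
    using lipschitz_path_to_vertex[OF assms(1)] by blast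
  obtain \<eta> where \<eta>: "1-lipschitz_on {0..1} \<eta>" "\<eta> ` {0..1::real} \<subseteq> gasket a" "\<eta> 0 = y" "\<eta> 1 = a 1"
    using lipschitz_path_to_vertex[OF assms(2)] by blast
  define \<zeta> where "\<zeta> t = (if t \<le> 1/2 then \<gamma> (2 * t) else \<eta> (2 - 2 * t))" for t
  have "2-lipschitz_on {0..1/2} (\<lambda>t. \<gamma> (2 * t))"
    using lipschitz_on_affine_reparam[OF \<gamma>(1), of "{0..1/2}" 0 2] by simp
  moreover have "2-lipschitz_on {1/2..1} (\<lambda>t. \<eta> (2 - 2 * t))"
    using lipschitz_on_affine_reparam[OF \<eta>(1), of "{1/2..1}" 2 "- 2"] by simp
  ultimately have "2-lipschitz_on {0..1} \<zeta>"
    unfolding \<zeta>_def by (intro lipschitz_on_concat) (auto simp: \<gamma> \<eta>)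
  moreover have "\<zeta> ` {0..1} \<subseteq> gasket a"
    using \<gamma>(2) \<eta>(2) by (auto simp: \<zeta>_def image_subset_iff)
  moreover have "\<zeta> 0 = x" "\<zeta> 1 = y" by (auto simp: \<zeta>_def \<gamma> \<eta>)
  ultimately show ?thesis by (rule geodesic_dist_bounds(1))
qed

lemma admissible_dist_le:
  assumes adm: "admissible (gasket_dist a) (gasket a) I \<xi>" and st: "s \<in> I" "t \<in> I" "s \<le> t"
  shows "dist (\<xi> s) (\<xi> t) \<le> t - s"
proof -
  let ?D = "metric_deriv (gasket_dist a) I \<xi>"
  have "is_interval I" using adm by (simp add: admissible_def abs_cont_curve_def)
  then have I: "{s..t} \<subseteq> I" by (intro subsetI mem_is_interval_1_I[OF _ st(1,2)]) auto
  have "\<xi> s \<in> gasket a" "\<xi> t \<in> gasket a"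
    using adm st by (auto simp: admissible_def abs_cont_curve_def)
  then have "dist (\<xi> s) (\<xi> t) \<le> gasket_dist a (\<xi> s) (\<xi> t)" by (rule dist_le_gasket_dist)
  also have "\<dots> \<le> set_lebesgue_integral lebesgue {s..t} ?D"
    using adm st by (auto simp: admissible_def abs_cont_curve_def)
  also have "\<dots> \<le> set_lebesgue_integral lebesgue {s..t} (\<lambda>_. 1)"
    unfolding set_lebesgue_integral_def
  proof (rule integral_mono_AE)
    show "integrable lebesgue (\<lambda>x. indicat_real {s..t} x *\<^sub>R ?D x)"
      using adm I by (auto simp: admissible_def abs_cont_curve_def set_integrable_def)
    have "AE x in lebesgue. x \<in> I \<longrightarrow> ?D x \<le> 1"
      using adm by (simp add: admissible_def)
    then show "AE x in lebesgue. indicat_real {s..t} x *\<^sub>R ?D x \<le> indicat_real {s..t} x *\<^sub>R 1"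
      by eventually_elim (use I in \<open>auto simp: indicator_def\<close>)
  qed (simp flip: lmeasurable_iff_integrable)
  also have "\<dots> = t - s" using st by (simp add: set_lebesgue_integral_def)
  finally show ?thesis .
qed

lemma admissible_continuous_on:
  assumes "admissible (gasket_dist a) (gasket a) I \<xi>"
  shows "continuous_on I \<xi>"
proof (rule lipschitz_on_continuous_on)
  show "1-lipschitz_on I \<xi>"
    using admissible_dist_le[OF assms]
    by (intro lipschitz_on_leI) (auto simp: dist_real_def)
qed

end

section \<open>Viscosity inequalities along curves in the gasket\<close>

text \<open>A supersolution controls \<open>w\<close> only strictly between the exit times; a strict
  inequality at an exit time is moved inside with this.\<close>

lemma continuous_on_gt_left_of_endpoint:
  fixes \<phi> :: "real \<Rightarrow> real"
  assumes "continuous_on {a..b} \<phi>" "a < b" "c < \<phi> b"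
  obtains t where "a < t" "t < b" "c < \<phi> t"
proof -
  have "\<not> (\<forall>t\<in>{a<..<b}. \<phi> t \<le> c)"
  proof
    assume "\<forall>t\<in>{a<..<b}. \<phi> t \<le> c"
    then have "\<phi> b \<le> c"
      using assms by (intro continuous_le_on_closure[of "{a<..<b}" \<phi> b c]) auto
    then show False using assms by simp
  qed
  then show ?thesis using that by force
qed

lemma exit_pos_attained:
  fixes \<xi> :: "real \<Rightarrow> 'a::metric_space"
  assumes cont: "continuous_on UNIV \<xi>" and "closed B" and fin: "\<bar>exit_pos B \<xi>\<bar> \<noteq> \<infinity>"
  obtains T where "0 \<le> T" "\<xi> T \<in> B" "exit_pos B \<xi> = ereal T" "\<And>t. 0 \<le> t \<Longrightarrow> \<xi> t \<in> B \<Longrightarrow> T \<le> t"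
proof -
  define P where "P = {0..} \<inter> \<xi> -` B"
  have "closed P"
    unfolding P_def
    by (intro continuous_closed_preimage continuous_on_subset[OF cont] \<open>closed B\<close>) auto
  moreover have "P \<noteq> {}"
  proof
    assume "P = {}"
    then have "{t. 0 \<le> t \<and> \<xi> t \<in> B} = {}" by (auto simp: P_def)
    then show False using fin unfolding exit_pos_def by (simp only:) (simp add: top_ereal_def)
  qed
  moreover have bdd: "bdd_below P" by (auto simp: P_def intro: bdd_belowI[of _ 0])
  ultimately have T: "Inf P \<in> P" by (intro closed_contains_Inf)
  have le: "Inf P \<le> t" if "0 \<le> t" "\<xi> t \<in> B" for t
    using bdd that by (intro cInf_lower) (auto simp: P_def)
  have "exit_pos B \<xi> = ereal (Inf P)"
    unfolding exit_pos_def using T le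
    by (intro antisym INF_lower2[of "Inf P"] INF_greatest) (auto simp: P_def)
  then show ?thesis using that T le by (auto simp: P_def)
qed

text \<open>Reversing time lets the attainment of the forward exit time serve for the backward one
  too.\<close>

lemma exit_neg_reflect: "exit_neg B \<xi> = - exit_pos B (\<lambda>t. \<xi> (- t))"
proof -
  have "{t. t \<le> 0 \<and> \<xi> t \<in> B} = uminus ` {t. 0 \<le> t \<and> \<xi> (- t) \<in> B}"
  proof (intro set_eqI iffI)
    fix t assume "t \<in> {t. t \<le> 0 \<and> \<xi> t \<in> B}"
    then show "t \<in> uminus ` {t. 0 \<le> t \<and> \<xi> (- t) \<in> B}"
      by (intro image_eqI[of _ _ "- t"]) auto
  qed auto
  then show ?thesis
    by (simp add: exit_neg_def exit_pos_def image_image ereal_SUP_uminus_eq flip: uminus_ereal.simps)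
qed

context
  fixes a :: "3 \<Rightarrow> real^2" and f :: "real^2 \<Rightarrow> real"
  assumes tri: "unit_triangle a"
begin

text \<open>The edge is run through at unit speed. The slope bound is available only at interior
  times, where the curve avoids \<Gamma>; the end points, possibly in \<Gamma>, are reached by
  continuity, which combines the two arcwise semicontinuities of a solution.\<close>

lemma subsolution_edge:
  assumes sol: "metric_solution (gasket_dist a) (gasket a) (range a) f u"
    and adj: "gasket_adj a n x y"
    and M: "\<And>z. z \<in> closed_segment x y \<Longrightarrow> f z \<le> M" "0 \<le> M"
  shows "u x \<le> u y + M * mesh n"
proof -
  define h where "h = mesh n"
  define e where "e = (1 / h) *\<^sub>R (y - x)"
  define \<xi> where "\<xi> t = x + t *\<^sub>R e" for t
  have "0 < h" by (simp add: h_def mesh_pos)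
  have "dist x y = h" using gasket_adj_dist[OF tri adj] by (simp add: h_def)
  then have e: "norm e = 1" using \<open>0 < h\<close> by (simp add: e_def dist_norm norm_minus_commute)
  have xy: "x \<noteq> y" "x \<in> gasket a" "y \<in> gasket a"
    using \<open>dist x y = h\<close> \<open>0 < h\<close> adj gasket_V_subset[of a n] by (auto simp: gasket_adj_def)
  have \<xi>_eq: "\<xi> t = (1 - t / h) *\<^sub>R x + (t / h) *\<^sub>R y" for t
    by (simp add: \<xi>_def e_def algebra_simps)
  have seg: "\<xi> t \<in> closed_segment x y" if "0 \<le> t" "t \<le> h" for t
    unfolding \<xi>_eq closed_segment_def using that \<open>0 < h\<close>
    by (intro CollectI exI[of _ "t / h"]) auto
  have S: "\<xi> t \<in> gasket a" if "0 \<le> t" "t \<le> h" for t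
    using seg[OF that] gasket_adj_segment_subset[OF tri adj] by blast
  have int: "\<xi> t \<in> gasket a - range a" if "0 < t" "t < h" for t
    using vertex_not_in_open_segment[OF tri xy(2,3), of "t / h"] xy(1) that S[of t]
    by (auto simp: \<xi>_eq)
  have "admissible (gasket_dist a) (gasket a) {0..h} \<xi>"
    unfolding \<xi>_def[abs_def] using \<open>0 < h\<close> e S
    by (intro unit_speed_segment_admissible) (auto simp: \<xi>_def islimpt_Icc)
  then have "usc_on {0..h} (u \<circ> \<xi>)" "lsc_on {0..h} (u \<circ> \<xi>)"
    using sol by (auto simp: metric_solution_def metric_subsolution_def metric_supersolution_def
        arcwise_usc_def arcwise_lsc_def)
  then have cont: "continuous_on {0..h} (u \<circ> \<xi>)" by (rule usc_lsc_imp_continuous_on)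
  have slope: "\<bar>p\<bar> \<le> M" if t: "0 < t" "t < h" and p: "p \<in> superdiff (u \<circ> \<xi>) t" for t p
  proof -
    define I where "I = {- t<..<h - t}"
    have I: "open I" "0 \<in> I" using t by (auto simp: I_def)
    have shift: "(\<lambda>s. \<xi> (t + s)) = (\<lambda>s. \<xi> t + s *\<^sub>R e)"
      by (auto simp: \<xi>_def scaleR_left_distrib add.assoc)
    have "(\<lambda>s. \<xi> (t + s)) ` I \<subseteq> gasket a - range a"
      by (rule image_subsetI, rule int) (auto simp: I_def)
    moreover have "admissible (gasket_dist a) (gasket a) I (\<lambda>s. \<xi> (t + s))"
      unfolding shift
    proof (rule unit_speed_segment_admissible)
      show "s islimpt I" if "s \<in> I" for s
        using that I(1) by (simp add: interior_limit_point interior_open)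
      show "\<xi> t + s *\<^sub>R e \<in> gasket a" if "s \<in> I" for s
        using S[of "t + s"] that fun_cong[OF shift, of s] by (simp add: I_def)
    qed (auto simp: I_def e)
    moreover have "p \<in> superdiff (u \<circ> (\<lambda>s. \<xi> (t + s))) 0"
      using p superdiff_shift[of "u \<circ> \<xi>" t] by (simp add: o_def)
    moreover have "\<xi> t \<in> gasket a - range a" by (rule int[OF t])
    ultimately have "\<bar>p\<bar> \<le> f (\<xi> t)"
      using sol I unfolding metric_solution_def metric_subsolution_def
      by (metis (no_types, lifting) add.right_neutral)
    also have "\<dots> \<le> M" using t by (intro M seg) auto
    finally show ?thesis .
  qed
  have "(u \<circ> \<xi>) 0 \<le> (u \<circ> \<xi>) h + M * h"
    using \<open>0 < h\<close> cont slope M(2) by (rule superdiff_bounded_decrease)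
  then show ?thesis using \<open>0 < h\<close> by (simp add: \<xi>_eq h_def)
qed

text \<open>\<open>G\<close> is an antiderivative of \<open>f - \<epsilon>\<close> along the curve.
  If the cost exceeded \<open>u x + \<epsilon>\<close> on both branches, \<open>w\<close> would
  violate \<open>subdiff_bounded_increase\<close> on an interval around 0; the branch that obeys the
  bound is returned, reversed in time if it is the backward one.\<close>

lemma supersolution_descent:
  assumes sol: "metric_solution (gasket_dist a) (gasket a) (range a) f u"
    and x: "x \<in> gasket a - range a" and cf: "continuous_on (gasket a) f"
    and \<epsilon>: "0 < \<epsilon>" "\<And>z. z \<in> gasket a \<Longrightarrow> \<epsilon> < f z"
  obtains \<xi> G T where "0 < T" "\<xi> 0 = x" "\<xi> T \<in> range a" "\<xi> ` {0..T} \<subseteq> gasket a"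
    "1-lipschitz_on {0..T} \<xi>" "\<And>t. 0 \<le> t \<Longrightarrow> t < T \<Longrightarrow> \<xi> t \<notin> range a"
    "continuous_on {0..T} G" "G 0 = 0"
    "\<And>t. 0 < t \<Longrightarrow> t < T \<Longrightarrow> (G has_real_derivative f (\<xi> t) - \<epsilon>) (at t)"
    "u (\<xi> T) + G T \<le> u x + \<epsilon>"
proof -
  obtain \<xi> w where adm: "admissible (gasket_dist a) (gasket a) UNIV \<xi>" and "\<xi> 0 = x"
    and lsc: "lsc_on UNIV w" and fin: "\<bar>exit_pos (range a) \<xi>\<bar> \<noteq> \<infinity>" "\<bar>exit_neg (range a) \<xi>\<bar> \<noteq> \<infinity>"
    and "w 0 = u x"
    and w: "\<And>t. exit_neg (range a) \<xi> < ereal t \<Longrightarrow> ereal t < exit_pos (range a) \<xi> \<Longrightarrow>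
      w t \<ge> u (\<xi> t) - \<epsilon> \<and> (\<forall>p\<in>subdiff w t. f (\<xi> t) - \<epsilon> \<le> \<bar>p\<bar>)"
    using sol x \<epsilon>(1) unfolding metric_solution_def metric_supersolution_def by metis
  have S: "\<xi> t \<in> gasket a" for t using adm by (auto simp: admissible_def abs_cont_curve_def)
  have cont: "continuous_on UNIV \<xi>" using adm by (rule admissible_continuous_on[OF tri])
  have lip: "1-lipschitz_on A \<xi>" for A
    using admissible_dist_le[OF tri adm] by (intro lipschitz_on_leI) (auto simp: dist_real_def)
  have cB: "closed (range a)" by (simp add: finite_imp_closed)
  obtain T2 where T2: "0 \<le> T2" "\<xi> T2 \<in> range a" "exit_pos (range a) \<xi> = ereal T2"
    "\<And>t. 0 \<le> t \<Longrightarrow> \<xi> t \<in> range a \<Longrightarrow> T2 \<le> t"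
    using exit_pos_attained[OF cont cB fin(1)] by blast
  have cont': "continuous_on UNIV (\<lambda>t. \<xi> (- t))"
    by (intro continuous_on_compose2[OF cont] continuous_intros) auto
  have fin': "\<bar>exit_pos (range a) (\<lambda>t. \<xi> (- t))\<bar> \<noteq> \<infinity>" using fin(2) by (simp add: exit_neg_reflect)
  obtain T1 where T1: "0 \<le> T1" "\<xi> (- T1) \<in> range a"
    "exit_pos (range a) (\<lambda>t. \<xi> (- t)) = ereal T1"
    "\<And>t. 0 \<le> t \<Longrightarrow> \<xi> (- t) \<in> range a \<Longrightarrow> T1 \<le> t"
    using exit_pos_attained[OF cont' cB fin'] by blast
  have neg: "exit_neg (range a) \<xi> = ereal (- T1)" by (simp add: exit_neg_reflect T1(3))
  have pos: "0 < T1" "0 < T2" using T1(1,2) T2(1,2) x \<open>\<xi> 0 = x\<close> by (auto simp: less_le)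
  define k where "k t = u (\<xi> t)" for t
  have "usc_on UNIV (u \<circ> \<xi>)" "lsc_on UNIV (u \<circ> \<xi>)"
    using sol adm by (auto simp: metric_solution_def metric_subsolution_def metric_supersolution_def
        arcwise_usc_def arcwise_lsc_def)
  then have "continuous_on UNIV (u \<circ> \<xi>)" by (rule usc_lsc_imp_continuous_on)
  then have ck: "continuous_on A k" for A
    by (auto simp: k_def[abs_def] o_def intro: continuous_on_subset)
  define F where "F t = f (\<xi> t) - \<epsilon>" for t
  have "continuous_on {- T1..T2} F" unfolding F_def
    using S by (intro continuous_intros continuous_on_compose2[OF cf] continuous_on_subset[OF cont]) auto
  then obtain G0 where G0: "\<And>t. t \<in> {- T1..T2} \<Longrightarrow>
      (G0 has_vector_derivative F t) (at t within {- T1..T2})"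
    using antiderivative_continuous by blast
  define G where "G t = G0 t - G0 0" for t
  have Gd: "(G has_real_derivative F t) (at t)" if "t \<in> {- T1<..<T2}" for t
  proof -
    have "(G0 has_real_derivative F t) (at t)"
      using G0[of t] that at_within_Icc_at[of "- T1" t T2]
      by (simp add: has_real_derivative_iff_has_vector_derivative)
    then show ?thesis unfolding G_def[abs_def] by (auto intro!: derivative_eq_intros)
  qed
  have cG: "continuous_on A G" if "A \<subseteq> {- T1..T2}" for A
  proof -
    have "continuous_on {- T1..T2} G0"
      using G0 by (intro continuous_on_vector_derivative) auto
    then show ?thesis unfolding G_def[abs_def]
      using that by (intro continuous_intros) (rule continuous_on_subset)
  qed
  have "k T2 + G T2 \<le> u x + \<epsilon> \<or> k (- T1) - G (- T1) \<le> u x + \<epsilon>"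
  proof (rule ccontr)
    assume "\<not> ?thesis"
    then have c: "u x + \<epsilon> < k T2 + G T2" "u x + \<epsilon> < k (- T1) - G (- T1)" by auto
    have "continuous_on {0..T2} (\<lambda>t. k t + G t)"
      using pos by (intro continuous_intros ck cG) auto
    from this pos(2) c(1) obtain t0 where t0: "0 < t0" "t0 < T2" "u x + \<epsilon> < k t0 + G t0"
      by (rule continuous_on_gt_left_of_endpoint)
    have "continuous_on {0..T1} (\<lambda>t. k (- t) - G (- t))"
      using pos by (intro continuous_intros continuous_on_compose2[OF ck] continuous_on_compose2[OF cG[of "{- T1..0}"]]) auto
    from this pos(1) c(2) obtain s0 where s0: "0 < s0" "s0 < T1" "u x + \<epsilon> < k (- s0) - G (- s0)"
      by (rule continuous_on_gt_left_of_endpoint)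
    have *: "w t \<ge> k t - \<epsilon>" "\<And>p. p \<in> subdiff w t \<Longrightarrow> F t \<le> \<bar>p\<bar>" if "t \<in> {- T1<..<T2}" for t
      using w[of t] that by (auto simp: neg T2(3) k_def F_def)
    have "min (w t0 + G t0) (w (- s0) - G (- s0)) \<le> w 0"
    proof (rule subdiff_bounded_increase[where F = F])
      show "(G has_real_derivative F r) (at r)" if "r \<in> {- s0<..<t0}" for r
        using that s0 t0 by (intro Gd) auto
      show "0 < F r" for r using \<epsilon>(2)[OF S] by (simp add: F_def)
      show "F r \<le> \<bar>p\<bar>" if "r \<in> {- s0<..<t0}" "p \<in> subdiff w r" for r p
        using that s0 t0 by (intro *(2)) auto
      show "continuous_on {- s0..t0} G" using s0 t0 by (intro cG) auto
    qed (use lsc s0 t0 in \<open>auto simp: G_def\<close>)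
    \<comment> \<open>The margin \<epsilon> of the conclusion is spent here: \<open>w\<close> may
      lie below \<open>u\<close> along the curve by that amount, while \<open>w 0 = u x\<close>
      exactly.\<close>
    moreover have "k t0 - \<epsilon> \<le> w t0" "k (- s0) - \<epsilon> \<le> w (- s0)"
      using s0 t0 pos by (auto intro!: *(1))
    ultimately show False using s0(3) t0(3) \<open>w 0 = u x\<close> by (simp add: min_def split: if_splits)
  qed
  then show ?thesis
  proof
    assume le: "k T2 + G T2 \<le> u x + \<epsilon>"
    show ?thesis
    proof (rule that[of T2 \<xi> G])
      show "(G has_real_derivative f (\<xi> t) - \<epsilon>) (at t)" if "0 < t" "t < T2" for t
        using Gd[of t] that pos by (simp add: F_def)
      show "\<xi> t \<notin> range a" if "0 \<le> t" "t < T2" for t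
        using T2(4)[of t] that by auto
      show "continuous_on {0..T2} G" using pos by (intro cG) auto
    qed (use le pos \<open>\<xi> 0 = x\<close> T2 S lip in \<open>auto simp: k_def G_def\<close>)
  next
    assume le: "k (- T1) - G (- T1) \<le> u x + \<epsilon>"
    show ?thesis
    \<comment> \<open>The two sign changes in \<open>- G (- t)\<close> cancel in the derivative, so
      the reversed branch again accumulates cost at the rate \<open>f - \<epsilon>\<close>.\<close>
    proof (rule that[of T1 "\<lambda>t. \<xi> (- t)" "\<lambda>t. - G (- t)"])
      show "((\<lambda>t. - G (- t)) has_real_derivative f (\<xi> (- t)) - \<epsilon>) (at t)" if "0 < t" "t < T1" for t
      proof -
        have "((\<lambda>t. G (- t)) has_real_derivative F (- t) * (- 1)) (at t)"
          using that pos by (intro DERIV_chain2[OF Gd]) (auto intro!: derivative_eq_intros)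
        then have "((\<lambda>t. - G (- t)) has_real_derivative - (F (- t) * (- 1))) (at t)"
          by (rule DERIV_minus)
        then show ?thesis by (simp add: F_def)
      qed
      show "\<xi> (- t) \<notin> range a" if "0 \<le> t" "t < T1" for t
        using T1(4)[of t] that by auto
      show "continuous_on {0..T1} (\<lambda>t. - G (- t))"
        using pos by (intro continuous_intros continuous_on_compose2[OF cG[of "{- T1..0}"]]) auto
      show "1-lipschitz_on {0..T1} (\<lambda>t. \<xi> (- t))"
        using lipschitz_on_affine_reparam[OF lip, of "{0..T1}" 0 "- 1" UNIV] by simp
    qed (use le pos \<open>\<xi> 0 = x\<close> T1 S in \<open>auto simp: k_def G_def\<close>)
  qed
qed

end

section \<open>The discrete eikonal equation\<close>

context
  fixes a :: "3 \<Rightarrow> real^2" and f g U :: "real^2 \<Rightarrow> real" and n :: nat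
  assumes tri: "unit_triangle a" and deq: "discrete_eikonal_solution a n f g U"
begin

lemma discrete_eikonal_boundary: "x \<in> range a \<Longrightarrow> U x = g x"
  using deq unfolding discrete_eikonal_solution_def by blast

text \<open>This is the dynamic programming form of the equation. The maximum is attained because
  the set of neighbours is finite and contains another corner of a cell at \<open>x\<close>.\<close>

lemma discrete_eikonal_Max:
  assumes "x \<in> gasket_V a n - range a"
  shows "(\<forall>y. gasket_adj a n x y \<longrightarrow> U x \<le> U y + mesh n * f x)
    \<and> (\<exists>y. gasket_adj a n x y \<and> U x = U y + mesh n * f x)"
proof -
  define A where "A = {y. gasket_adj a n y x}"
  define \<phi> where "\<phi> y = - (1 / mesh n) * (U y - U x)" for y
  have "A \<subseteq> gasket_V a n" by (auto simp: A_def gasket_adj_def)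
  then have "finite A" using finite_gasket_V finite_subset by blast
  obtain w i where w: "length w = n" "x = gasket_comp a w (a i)"
    using assms by (auto simp: gasket_V_def)
  have "\<exists>j :: 3. j \<noteq> i" by (rule exI[of _ "i + 1"]) simp
  then obtain j where "j \<noteq> i" by blast
  then have "gasket_comp a w (a j) \<in> A"
    using gasket_adj_corners[OF tri w(1)] by (simp add: A_def w(2))
  then have "A \<noteq> {}" by blast
  have Max: "Max (\<phi> ` A) = f x"
    using deq assms by (simp add: discrete_eikonal_solution_def A_def \<phi>_def)
  have \<phi>: "U x = U y + mesh n * \<phi> y" for y
    using mesh_pos[of n] by (simp add: \<phi>_def)
  have adj: "y \<in> A \<longleftrightarrow> gasket_adj a n x y" for y
    using gasket_adj_sym[OF tri] by (auto simp: A_def)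
  have "\<phi> y \<le> f x" if "y \<in> A" for y
    using that \<open>finite A\<close> unfolding Max[symmetric] by simp
  then have "U x \<le> U y + mesh n * f x" if "y \<in> A" for y
    using \<phi>[of y] mesh_pos[of n] mult_left_mono[of "\<phi> y" "f x" "mesh n"] that by fastforce
  moreover have "f x \<in> \<phi> ` A"
    unfolding Max[symmetric] using \<open>finite A\<close> \<open>A \<noteq> {}\<close> by (intro Max_in) auto
  then obtain y where "y \<in> A" "f x = \<phi> y" by blast
  then have "y \<in> A \<and> U x = U y + mesh n * f x" using \<phi>[of y] by simp
  ultimately show ?thesis unfolding adj by blast
qed

lemmas discrete_eikonal_le = discrete_eikonal_Max[THEN conjunct1, rule_format]

lemma discrete_eikonal_descent:
  assumes "x \<in> gasket_V a n - range a"
  obtains y where "gasket_adj a n x y" "U x = U y + mesh n * f x"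
  using discrete_eikonal_Max[OF assms] by blast

text \<open>
  The vertices which a curve of speed at most \<open>1\<close> visits form a path of the graph, and it needs time
  at least \<open>mesh n\<close> from one to the next.
\<close>
lemma discrete_eikonal_le_along_curve:
  fixes \<xi> :: "real \<Rightarrow> real^2"
  assumes lip: "1-lipschitz_on {0..T} \<xi>" and sub: "\<xi> ` {0..T} \<subseteq> gasket a" and exit: "\<xi> T \<in> range a"
    and boundary: "\<And>t. t \<in> {0..T} \<Longrightarrow> \<xi> t \<in> range a \<Longrightarrow> g (\<xi> t) \<le> B t"
    and step: "\<And>s t. 0 \<le> s \<Longrightarrow> t \<le> T \<Longrightarrow> mesh n \<le> t - s \<Longrightarrow> \<xi> s \<notin> range a \<Longrightarrow>
      (\<And>r. r \<in> {s..t} \<Longrightarrow> dist (\<xi> s) (\<xi> r) \<le> mesh n) \<Longrightarrow> mesh n * f (\<xi> s) \<le> B s - B t"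
    and "t \<in> {0..T}" "\<xi> t \<in> gasket_V a n"
  shows "U (\<xi> t) \<le> B t"
proof -
  \<comment> \<open>Induction on the remaining time in units of \<open>mesh n\<close>: each passage
    to a neighbour uses up at least one unit, and \<open>k = 0\<close> is impossible since
    \<open>s \<le> T\<close>.\<close>
  have "U (\<xi> s) \<le> B s" if "T - s < k * mesh n" "s \<in> {0..T}" "\<xi> s \<in> gasket_V a n" for k :: nat and s
    using that
  proof (induction k arbitrary: s)
    case (Suc k)
    show ?case
    proof (cases "\<xi> s \<in> range a")
      case True
      then show ?thesis using boundary[OF Suc.prems(2)] by (simp add: discrete_eikonal_boundary)
    next
      case False
      have T: "\<xi> T \<in> gasket_V a n" "\<xi> T \<noteq> \<xi> s" using exit False by (auto simp: vertex_in_gasket_V)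
      have cont: "continuous_on {s..T} \<xi>"
        using Suc.prems(2) by (intro continuous_on_subset[OF lipschitz_on_continuous_on[OF lip]]) auto
      have "\<xi> ` {s..T} \<subseteq> gasket a" "s \<le> T" using Suc.prems(2) sub by auto
      then obtain t where t: "s < t" "t \<le> T" "gasket_adj a n (\<xi> s) (\<xi> t)"
        "\<And>r. r \<in> {s..t} \<Longrightarrow> dist (\<xi> s) (\<xi> r) \<le> mesh n"
        using curve_reaches_neighbour[OF tri cont _ _ Suc.prems(3) T] by blast
      have "mesh n = dist (\<xi> s) (\<xi> t)" using gasket_adj_dist[OF tri t(3)] by simp
      also have "\<dots> \<le> t - s"
        using lipschitz_onD[OF lip, of s t] Suc.prems(2) t(1,2) by (simp add: dist_real_def)
      finally have ts: "mesh n \<le> t - s" .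
      have "U (\<xi> t) \<le> B t"
        using Suc.prems t ts by (intro Suc.IH) (auto simp: gasket_adj_def algebra_simps)
      moreover have "U (\<xi> s) \<le> U (\<xi> t) + mesh n * f (\<xi> s)"
        using Suc.prems(3) False t(3) by (intro discrete_eikonal_le) auto
      moreover have "mesh n * f (\<xi> s) \<le> B s - B t"
        using Suc.prems(2) t(2,4) ts False by (intro step) auto
      ultimately show ?thesis by simp
    qed
  qed simp
  moreover obtain k :: nat where "(T - t) / mesh n < k" using reals_Archimedean2 by blast
  then have "T - t < k * mesh n" using mesh_pos[of n] by (simp add: field_simps)
  ultimately show ?thesis using assms(6,7) by blast
qed

text \<open>A path of length at most 1 to a vertex is compared with the linear bound
  \<open>C + M * (1 - t)\<close>. The result is independent of \<open>n\<close>, which makes the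
  constant of the final estimate uniform.\<close>

lemma discrete_eikonal_bounded:
  assumes "\<And>z. z \<in> gasket a \<Longrightarrow> f z \<le> M" "\<And>z. z \<in> range a \<Longrightarrow> g z \<le> C" "0 \<le> M"
    and "x \<in> gasket_V a n"
  shows "U x \<le> C + M"
proof -
  have "x \<in> gasket a" using assms(4) gasket_V_subset by blast
  then obtain \<gamma> where \<gamma>: "1-lipschitz_on {0..1} \<gamma>" "\<gamma> ` {0..1::real} \<subseteq> gasket a" "\<gamma> 0 = x" "\<gamma> 1 = a 1"
    using lipschitz_path_to_vertex[OF tri] by blast
  have "U (\<gamma> 0) \<le> C + M * (1 - 0)"
  proof (rule discrete_eikonal_le_along_curve[OF \<gamma>(1,2)])
    show "g (\<gamma> t) \<le> C + M * (1 - t)" if "t \<in> {0..1}" "\<gamma> t \<in> range a" for t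
      using assms(2)[OF that(2)] assms(3) that(1) by (simp add: add_increasing2)
    show "mesh n * f (\<gamma> s) \<le> C + M * (1 - s) - (C + M * (1 - t))"
      if "0 \<le> s" "t \<le> 1" "mesh n \<le> t - s" for s t
    proof -
      have "\<gamma> s \<in> gasket a" using \<gamma>(2) that mesh_pos[of n] by (auto simp: image_subset_iff)
      then have "mesh n * f (\<gamma> s) \<le> mesh n * M" using assms(1) mesh_pos[of n] by simp
      also have "\<dots> \<le> (t - s) * M" using that(3) assms(3) by (rule mult_right_mono)
      finally show ?thesis by (simp add: algebra_simps)
    qed
  qed (use \<gamma> assms(4) in auto)
  then show ?thesis using \<gamma> by simp
qed

text \<open>
  Along an optimal path \<open>U\<close> drops by at least \<open>m * mesh n\<close> in each step, which bounds the number of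
  steps and hence the accumulated error.
\<close>
lemma solution_le_discrete_eikonal:
  assumes sol: "metric_solution (gasket_dist a) (gasket a) (range a) f u"
    and bd: "\<And>z. z \<in> range a \<Longrightarrow> u z = g z"
    and m: "0 < m" "\<And>z. z \<in> gasket a \<Longrightarrow> m \<le> f z" and "0 \<le> \<omega>"
    and \<omega>: "\<And>y z. y \<in> gasket a \<Longrightarrow> z \<in> gasket a \<Longrightarrow> dist y z \<le> mesh n \<Longrightarrow> \<bar>f y - f z\<bar> \<le> \<omega>"
    and c: "\<And>z. z \<in> range a \<Longrightarrow> c \<le> g z"
    and "x \<in> gasket_V a n"
  shows "u x \<le> U x + \<omega> / m * (U x - c)"
proof -
  \<comment> \<open>The lower bound \<open>L\<close> ends the descent: \<open>U z - L\<close>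
    measured in units of \<open>mesh n * m\<close> is the induction parameter, and
    \<open>k = 0\<close> contradicts minimality.\<close>
  define L where "L = Min (U ` gasket_V a n)"
  have L: "L \<le> U z" if "z \<in> gasket_V a n" for z
    unfolding L_def using that finite_gasket_V by (intro Min_le) auto
  have "c \<le> U z \<and> u z \<le> U z + \<omega> / m * (U z - c)"
    if "U z - L < k * (mesh n * m)" "z \<in> gasket_V a n" for k :: nat and z
    using that
  proof (induction k arbitrary: z)
    case 0
    then show ?case using L[of z] by simp
  next
    case (Suc k)
    show ?case
    proof (cases "z \<in> range a")
      case True
      then show ?thesis
        using c[OF True] bd[OF True] discrete_eikonal_boundary[OF True] \<open>0 \<le> \<omega>\<close> m(1) by simp
    next
      case False
      then obtain y where y: "gasket_adj a n z y" "U z = U y + mesh n * f z"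
        using Suc.prems(2) by (metis DiffI discrete_eikonal_descent)
      have zS: "z \<in> gasket a" and yV: "y \<in> gasket_V a n"
        using Suc.prems(2) gasket_V_subset y(1) by (auto simp: gasket_adj_def)
      have drop: "mesh n * m \<le> U z - U y" using m(2)[OF zS] mesh_pos[of n] y(2) by simp
      then have IH: "c \<le> U y" "u y \<le> U y + \<omega> / m * (U y - c)"
        using Suc.IH[of y] Suc.prems(1) yV by (auto simp: algebra_simps)
      have "u z \<le> u y + (f z + \<omega>) * mesh n"
      proof (rule subsolution_edge[OF tri sol y(1)])
        fix q assume q: "q \<in> closed_segment z y"
        then have "q \<in> gasket a" using gasket_adj_segment_subset[OF tri y(1)] by blast
        moreover have "dist z q \<le> mesh n"
          using dist_in_closed_segment(1)[OF q] gasket_adj_dist[OF tri y(1)] by (simp add: dist_commute)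
        ultimately show "f q \<le> f z + \<omega>" using \<omega>[OF zS, of q] by (simp add: abs_le_iff)
      qed (use m(1) m(2)[OF zS] \<open>0 \<le> \<omega>\<close> in simp)
      also have "\<dots> \<le> U z + \<omega> * mesh n + \<omega> / m * (U y - c)"
        using IH(2) y(2) by (simp add: algebra_simps)
      \<comment> \<open>The error of one edge is charged to the decrease of \<open>U\<close> along
        it, which is at least \<open>mesh n * m\<close>; the charges telescope to
        \<open>\<omega> / m * (U z - c)\<close>.\<close>
      also have "\<omega> * mesh n = \<omega> / m * (mesh n * m)" using m(1) by simp
      also have "U z + \<omega> / m * (mesh n * m) + \<omega> / m * (U y - c)
          = U z + \<omega> / m * (mesh n * m + U y - c)"
        by (simp only: distrib_left right_diff_distrib)
      also have "\<dots> \<le> U z + \<omega> / m * (U z - c)"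
        using drop \<open>0 \<le> \<omega>\<close> m(1) by (intro add_left_mono mult_left_mono) auto
      finally have "u z \<le> U z + \<omega> / m * (U z - c)" .
      moreover have "c \<le> U z" using IH(1) drop mesh_pos[of n] m(1) by (smt (verit) mult_pos_pos)
      ultimately show ?thesis by simp
    qed
  qed
  moreover have "0 < mesh n * m" using mesh_pos[of n] m(1) by simp
  moreover obtain k :: nat where "(U x - L) / (mesh n * m) < k" using reals_Archimedean2 by blast
  ultimately have "U x - L < k * (mesh n * m)" by (simp add: field_simps)
  then show ?thesis
    using \<open>\<And>z k. U z - L < real k * (mesh n * m) \<Longrightarrow> z \<in> gasket_V a n \<Longrightarrow> _\<close> assms(8) by blast
qed

text \<open>The descent curve is taken with \<epsilon> equal to \<omega>. The bound along it is the
  remaining cost plus \<open>2 * \<omega>\<close> per unit of remaining time, and the total time is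
  bounded because the cost rate stays above \<open>m / 2\<close>.\<close>

lemma discrete_eikonal_le_solution:
  assumes sol: "metric_solution (gasket_dist a) (gasket a) (range a) f u"
    and bd: "\<And>z. z \<in> range a \<Longrightarrow> u z = g z" and cf: "continuous_on (gasket a) f"
    and m: "\<And>z. z \<in> gasket a \<Longrightarrow> m \<le> f z" and "0 < \<omega>" "2 * \<omega> < m"
    and \<omega>: "\<And>y z. y \<in> gasket a \<Longrightarrow> z \<in> gasket a \<Longrightarrow> dist y z \<le> mesh n \<Longrightarrow> \<bar>f y - f z\<bar> \<le> \<omega>"
    and c: "\<And>z. z \<in> range a \<Longrightarrow> c \<le> g z" and "u x \<le> C"
    and x: "x \<in> gasket_V a n"
  shows "U x \<le> u x + \<omega> + 4 * \<omega> / m * (C + \<omega> - c)"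
proof (cases "x \<in> range a")
  case True
  have "0 \<le> 4 * \<omega> / m * (C + \<omega> - c)"
    using c[OF True] bd[OF True] assms(5,6,9) by (intro mult_nonneg_nonneg) auto
  then show ?thesis using bd[OF True] discrete_eikonal_boundary[OF True] \<open>0 < \<omega>\<close> by simp
next
  case False
  have xS: "x \<in> gasket a - range a" using x gasket_V_subset False by blast
  have ltf: "\<omega> < f z" if "z \<in> gasket a" for z using m[OF that] assms(5,6) by linarith
  obtain \<xi> G T where "0 < T" and \<xi>: "\<xi> 0 = x" "\<xi> T \<in> range a" "\<xi> ` {0..T} \<subseteq> gasket a"
    "1-lipschitz_on {0..T} \<xi>" "\<And>t. 0 \<le> t \<Longrightarrow> t < T \<Longrightarrow> \<xi> t \<notin> range a"
    and cG: "continuous_on {0..T} G" and "G 0 = 0"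
    and dG: "\<And>t. 0 < t \<Longrightarrow> t < T \<Longrightarrow> (G has_real_derivative f (\<xi> t) - \<omega>) (at t)"
    and le: "u (\<xi> T) + G T \<le> u x + \<omega>"
    using supersolution_descent[OF tri sol xS cf assms(5) ltf] by metis
  have S: "\<xi> t \<in> gasket a" if "t \<in> {0..T}" for t using \<xi>(3) that by blast
  have incr: "q * (t - s) \<le> G t - G s"
    if "0 \<le> s" "s \<le> t" "t \<le> T" "\<And>r. s < r \<Longrightarrow> r < t \<Longrightarrow> q \<le> f (\<xi> r) - \<omega>" for q s t
  proof -
    have "G s - q * s \<le> G t - q * t"
    proof (rule DERIV_nonneg_imp_increasing_open[OF that(2)])
      fix r assume r: "s < r" "r < t"
      have "((\<lambda>t. G t - q * t) has_real_derivative f (\<xi> r) - \<omega> - q) (at r)"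
        using r that(1,3) by (auto intro!: derivative_eq_intros dG)
      then show "\<exists>y. ((\<lambda>t. G t - q * t) has_real_derivative y) (at r) \<and> 0 \<le> y"
        using that(4)[OF r] by (intro exI[of _ "f (\<xi> r) - \<omega> - q"]) auto
    next
      show "continuous_on {s..t} (\<lambda>t. G t - q * t)"
        using that by (intro continuous_intros continuous_on_subset[OF cG]) auto
    qed
    then show ?thesis by (simp add: algebra_simps)
  qed
  have "U (\<xi> 0) \<le> g (\<xi> T) + (G T - G 0) + 2 * \<omega> * (T - 0)"
  proof (rule discrete_eikonal_le_along_curve[OF \<xi>(4,3,2)])
    show "g (\<xi> t) \<le> g (\<xi> T) + (G T - G t) + 2 * \<omega> * (T - t)" if "t \<in> {0..T}" "\<xi> t \<in> range a" for t
      using \<xi>(5)[of t] that by (cases "t = T") auto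
    fix s t assume st: "0 \<le> s" "t \<le> T" "mesh n \<le> t - s"
      and near: "\<And>r. r \<in> {s..t} \<Longrightarrow> dist (\<xi> s) (\<xi> r) \<le> mesh n"
    have "s < t" using st mesh_pos[of n] by linarith
    \<comment> \<open>One \<omega> is the oscillation of \<open>f\<close> within
      \<open>mesh n\<close> of \<open>\<xi> s\<close>, the other is the loss in the derivative of
      \<open>G\<close>.\<close>
    have "(f (\<xi> s) - 2 * \<omega>) * (t - s) \<le> G t - G s"
    proof (rule incr)
      fix r assume "s < r" "r < t"
      then have "\<bar>f (\<xi> s) - f (\<xi> r)\<bar> \<le> \<omega>" using st by (intro \<omega> S near) auto
      then show "f (\<xi> s) - 2 * \<omega> \<le> f (\<xi> r) - \<omega>" by linarith
    qed (use st \<open>s < t\<close> in auto)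
    \<comment> \<open>Since \<open>f\<close> is positive, a curve that takes longer than
      \<open>mesh n\<close> between two vertices only pays more than the graph does.\<close>
    moreover have "mesh n * f (\<xi> s) \<le> (t - s) * f (\<xi> s)"
      using st \<open>s < t\<close> ltf[OF S, of s] \<open>0 < \<omega>\<close> by (intro mult_right_mono) auto
    ultimately show "mesh n * f (\<xi> s)
        \<le> g (\<xi> T) + (G T - G s) + 2 * \<omega> * (T - s) - (g (\<xi> T) + (G T - G t) + 2 * \<omega> * (T - t))"
      by (simp add: algebra_simps)
  qed (use \<open>0 < T\<close> \<xi>(1) x in auto)
  then have "U x \<le> u x + \<omega> + 2 * \<omega> * T"
    using le bd[OF \<xi>(2)] \<open>G 0 = 0\<close> \<xi>(1) by simp
  \<comment> \<open>From \<open>2 * \<omega> < m\<close> the derivative of \<open>G\<close> is at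
    least \<open>m / 2\<close>, while \<open>G T\<close> is at most
    \<open>u x + \<omega> - u (\<xi> T)\<close>.\<close>
  moreover have "T \<le> 2 / m * (C + \<omega> - c)"
  proof -
    have "m / 2 * (T - 0) \<le> G T - G 0"
    proof (rule incr)
      show "m / 2 \<le> f (\<xi> r) - \<omega>" if "0 < r" "r < T" for r
        using m[OF S, of r] that assms(6) by simp
    qed (use \<open>0 < T\<close> in auto)
    also have "\<dots> \<le> C + \<omega> - c"
      using le bd[OF \<xi>(2)] c[OF \<xi>(2)] \<open>G 0 = 0\<close> assms(9) by simp
    finally show ?thesis using assms(5,6) by (simp add: field_simps)
  qed
  then have "2 * \<omega> * T \<le> 2 * \<omega> * (2 / m * (C + \<omega> - c))"
    using \<open>0 < \<omega>\<close> by (intro mult_left_mono) auto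
  ultimately show ?thesis by (simp add: field_simps)
qed

end

section \<open>The uniform error estimate and the limit\<close>

theorem theorem5p2:
  fixes a :: "3 \<Rightarrow> real^2"
    and f g u :: "real^2 \<Rightarrow> real"
    and U :: "nat \<Rightarrow> real^2 \<Rightarrow> real"
  assumes "unit_triangle a"
    and "continuous_on (gasket a) f"
    and "0 < (INF x \<in> gasket a. f x)"
    and "\<And>x y. x \<in> range a \<Longrightarrow> y \<in> range a \<Longrightarrow> ereal (g x) \<le> curve_cost_inf a f g x y"
    and "\<And>n x y. x \<in> range a \<Longrightarrow> y \<in> range a \<Longrightarrow> ereal (g x) \<le> graph_cost_inf a n f g x y"
    and "\<And>n. discrete_eikonal_solution a n f g (U n)"
    and "metric_solution (gasket_dist a) (gasket a) (range a) f u"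
    and "\<And>x. x \<in> range a \<Longrightarrow> u x = g x"
  shows "(\<lambda>n. SUP x \<in> gasket_V a n. \<bar>U n x - u x\<bar>) \<longlonglongrightarrow> 0"
proof -
  note tri = assms(1) and sol = assms(7) and bd = assms(8)
  have compact: "compact (gasket a)" by (rule compact_gasket[OF tri])
  define m where "m = (INF x \<in> gasket a. f x)"
  have bdd: "bounded (f ` gasket a)"
    by (intro compact_imp_bounded compact_continuous_image assms(2) compact)
  have m: "m \<le> f z" if "z \<in> gasket a" for z
    unfolding m_def using that bounded_imp_bdd_below[OF bdd] by (intro cINF_lower)
  have "0 < m" using assms(3) by (simp add: m_def)
  obtain M where M: "\<And>z. z \<in> gasket a \<Longrightarrow> f z \<le> M"
    using bounded_imp_bdd_above[OF bdd] by (auto simp: bdd_above_def)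
  have "0 \<le> M" using m M vertex_in_gasket[OF tri, of 1] \<open>0 < m\<close> by force
  define c C where "c = Min (g ` range a)" and "C = Max (g ` range a)"
  have c: "c \<le> g z" "g z \<le> C" if "z \<in> range a" for z
    using that by (auto simp: c_def C_def)
  \<comment> \<open>\<open>K\<close> is the sum of the factors of \<omega> in the two one-sided
    estimates, so it dominates each. Inside the second factor,
    \<open>C + M + (C + M - c) / m\<close> is the upper bound for \<open>u\<close> on the vertices
    and the summand 1 replaces \<omega>.\<close>
  define K where "K = 1 + (C + M - c) / m + 4 / m * (C + M + (C + M - c) / m + 1 - c)"
  have "c \<le> C" using c[of "a 1"] by simp
  then have q: "0 \<le> (C + M - c) / m" using \<open>0 \<le> M\<close> \<open>0 < m\<close> by simp
  then have q': "0 \<le> 4 / m * (C + M + (C + M - c) / m + 1 - c)"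
  proof -
    have "0 \<le> C + M + (C + M - c) / m + 1 - c" using q \<open>c \<le> C\<close> \<open>0 \<le> M\<close> by linarith
    then show ?thesis using \<open>0 < m\<close> by (intro mult_nonneg_nonneg) auto
  qed
  then have "1 \<le> K" using q unfolding K_def by linarith
  have main: "\<bar>U n x - u x\<bar> \<le> \<omega> * K"
    if \<omega>: "0 < \<omega>" "\<omega> \<le> 1" "2 * \<omega> < m" and x: "x \<in> gasket_V a n"
      and mod: "\<And>y z. y \<in> gasket a \<Longrightarrow> z \<in> gasket a \<Longrightarrow> dist y z \<le> mesh n \<Longrightarrow> \<bar>f y - f z\<bar> \<le> \<omega>"
    for \<omega> n x
  proof -
    note deq = assms(6)[of n]
    have "0 \<le> \<omega>" using \<omega>(1) by simp
    have U: "U n x \<le> C + M"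
      using discrete_eikonal_bounded[OF tri deq M c(2) \<open>0 \<le> M\<close> x] by simp
    have "u x \<le> U n x + \<omega> / m * (U n x - c)"
      by (rule solution_le_discrete_eikonal[OF tri deq sol bd \<open>0 < m\<close> m \<open>0 \<le> \<omega>\<close> mod c(1) x])
    also have "\<dots> \<le> U n x + \<omega> / m * (C + M - c)"
      using U \<omega>(1) \<open>0 < m\<close> by (intro add_left_mono mult_left_mono) auto
    finally have A: "u x \<le> U n x + \<omega> * ((C + M - c) / m)" by simp
    also have "\<dots> \<le> C + M + 1 * ((C + M - c) / m)"
      using U \<omega>(2) q by (intro add_mono mult_right_mono)
    finally have "u x \<le> C + M + (C + M - c) / m" by simp
    from discrete_eikonal_le_solution[OF tri deq sol bd assms(2) m \<omega>(1,3) mod c(1) this x]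
    have "U n x \<le> u x + \<omega> + 4 * \<omega> / m * (C + M + (C + M - c) / m + \<omega> - c)" by simp
    also have "\<dots> \<le> u x + \<omega> + 4 * \<omega> / m * (C + M + (C + M - c) / m + 1 - c)"
      using \<omega> \<open>0 < m\<close> by (intro add_left_mono mult_left_mono) auto
    also have "\<dots> = u x + \<omega> * (1 + 4 / m * (C + M + (C + M - c) / m + 1 - c))"
      by (simp add: algebra_simps)
    also have "\<dots> \<le> u x + \<omega> * K"
      using \<omega>(1) q by (intro add_left_mono mult_left_mono) (auto simp: K_def)
    finally have B: "U n x \<le> u x + \<omega> * K" .
    have "(C + M - c) / m \<le> K" using q' unfolding K_def by linarith
    then have "\<omega> * ((C + M - c) / m) \<le> \<omega> * K" using \<omega>(1) by (intro mult_left_mono) auto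
    with A B show ?thesis by (simp add: abs_le_iff)
  qed
  show ?thesis
  proof (rule LIMSEQ_I)
    fix e :: real assume "0 < e"
    \<comment> \<open>The bound \<open>m / 3\<close> secures \<open>2 * \<omega> < m\<close>, and
      \<open>e / (2 * K)\<close> brings the error to at most \<open>e / 2\<close>, hence strictly
      below \<open>e\<close> also after taking the supremum.\<close>
    define \<omega> where "\<omega> = min (min 1 (m / 3)) (e / (2 * K))"
    have "\<omega> \<le> m / 3" "\<omega> \<le> e / (2 * K)" by (simp_all add: \<omega>_def)
    moreover have "0 < \<omega>" "\<omega> \<le> 1"
      using \<open>0 < m\<close> \<open>0 < e\<close> \<open>1 \<le> K\<close> by (simp_all add: \<omega>_def)
    ultimately have \<omega>: "0 < \<omega>" "\<omega> \<le> 1" "2 * \<omega> < m" "\<omega> \<le> e / (2 * K)"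
      using \<open>0 < m\<close> by auto
    then have \<omega>K: "\<omega> * K < e" using \<omega>(4) \<open>1 \<le> K\<close> \<open>0 < e\<close> by (simp add: field_simps)
    have "uniformly_continuous_on (gasket a) f"
      by (rule compact_uniformly_continuous[OF assms(2) compact])
    then obtain d where "0 < d" and d: "\<And>y z. y \<in> gasket a \<Longrightarrow> z \<in> gasket a \<Longrightarrow> dist y z < d \<Longrightarrow> dist (f y) (f z) < \<omega>"
      using \<omega>(1) unfolding uniformly_continuous_on_def by (metis dist_commute)
    obtain N where N: "\<And>n. N \<le> n \<Longrightarrow> mesh n < d"
      using order_tendstoD(2)[OF mesh_tendsto_0 \<open>0 < d\<close>] by (auto simp: eventually_sequentially)
    show "\<exists>N. \<forall>n\<ge>N. norm ((SUP x\<in>gasket_V a n. \<bar>U n x - u x\<bar>) - 0) < e"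
    proof (intro exI[of _ N] allI impI)
      fix n assume "N \<le> n"
      have mod: "\<bar>f y - f z\<bar> \<le> \<omega>" if "y \<in> gasket a" "z \<in> gasket a" "dist y z \<le> mesh n" for y z
        using d[OF that(1,2)] that(3) N[OF \<open>N \<le> n\<close>] by (simp add: dist_real_def)
      have le: "\<bar>U n x - u x\<bar> \<le> \<omega> * K" if "x \<in> gasket_V a n" for x
        using \<omega>(1-3) that mod by (rule main)
      have "(SUP x\<in>gasket_V a n. \<bar>U n x - u x\<bar>) \<le> \<omega> * K"
        using le vertex_in_gasket_V[of a 1 n] by (intro cSUP_least) auto
      moreover have "0 \<le> (SUP x\<in>gasket_V a n. \<bar>U n x - u x\<bar>)"
        using finite_gasket_V[of a n] vertex_in_gasket_V[of a 1 n]
        by (intro cSUP_upper2[where x = "a 1"]) auto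
      ultimately show "norm ((SUP x\<in>gasket_V a n. \<bar>U n x - u x\<bar>) - 0) < e" using \<omega>K by simp
    qed
  qed
qed

end
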